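(* Let $n\ge 2$ and $\delta>0$. Then the bilinear Bochner-Riesz operator $S^{\delta}$ is bounded from $L^2(\mathbb{R}^n)\times L^2(\mathbb{R}^n)$ to $L^1(\mathbb{R}^n)$; that is, for some constant $C=C_\delta$ we have $$\|S^{\delta}\|_{L^{2}\times L^{2}\to L^{1}}\le C .$$ Moreover, this result fails when $\delta=0$, i.e., $S^{0}$ is not bounded from $L^2(\mathbb{R}^n)\times L^2(\mathbb{R}^n)$ to $L^1(\mathbb{R}^n)$.
   Context: The Fourier transform on $\mathbb{R}^n$ is $\widehat f(\xi)=\int_{\mathbb{R}^n}e^{-2\pi i x\cdot\xi}f(x)\,dx$. For $\delta\ge 0$ and Schwartz functions $f,g$ on $\mathbb{R}^n$, the bilinear Bochner-Riesz operator is $$S^{\delta}(f,g)(x)=\iint_{|\xi|^2+|\eta|^2\le 1}(1-|\xi|^2-|\eta|^2)^{\delta}\,\widehat f(\xi)\,\widehat g(\eta)\,e^{2\pi i x\cdot(\xi+\eta)}\,d\xi\,d\eta .$$ "Bounded from $L^{p_1}\times L^{p_2}$ to $L^p$" means that there is a constant $C$ with $\|S^\delta(f,g)\|_p\le C\|f\|_{p_1}\|g\|_{p_2}$ for all Schwartz $f,g$; the least such $C$ is the operator norm $\|S^\delta\|_{L^{p_1}\times L^{p_2}\to L^p}$. *)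

theory Defs
  imports "HOL-Analysis.Analysis"
begin

fun iter_partial :: "'a::euclidean_space list \<Rightarrow> ('a \<Rightarrow> complex) \<Rightarrow> 'a \<Rightarrow> complex" where
  "iter_partial [] f = f"
| "iter_partial (b # bs) f = (\<lambda>x. frechet_derivative (iter_partial bs f) (at x) b)"

text \<open>Differentiability of every iterated partial derivative makes all of them continuous, so this
  is smoothness together with rapid decay of all derivatives. The lists enumerate the basis vectors of
  the successive derivatives, so they run through all multi-indices.\<close>

definition schwartz :: "('a::euclidean_space \<Rightarrow> complex) \<Rightarrow> bool" where
  "schwartz f \<longleftrightarrow>
     (\<forall>bs. set bs \<subseteq> Basis \<longrightarrow>
        (\<forall>x. iter_partial bs f differentiable (at x)) \<and>
        (\<forall>k::nat. bounded (range (\<lambda>x. norm x ^ k *\<^sub>R iter_partial bs f x))))"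

definition fourier :: "('a::euclidean_space \<Rightarrow> complex) \<Rightarrow> 'a \<Rightarrow> complex" where
  "fourier f \<xi> = (LINT x|lborel. exp (- 2 * complex_of_real pi * \<i> * complex_of_real (x \<bullet> \<xi>)) * f x)"

text \<open>The case distinction is needed because \<open>0 powr 0 = 0\<close> in HOL, whereas for \<open>\<delta> = 0\<close> the
  multiplier is the indicator function of the closed unit ball.\<close>

definition br_weight :: "real \<Rightarrow> real \<Rightarrow> real" where
  "br_weight \<delta> t = (if \<delta> = 0 then 1 else t powr \<delta>)"

definition bilinear_BR ::
  "real \<Rightarrow> ('a::euclidean_space \<Rightarrow> complex) \<Rightarrow> ('a \<Rightarrow> complex) \<Rightarrow> 'a \<Rightarrow> complex" where
  "bilinear_BR \<delta> f g x =
     (LINT p : {(\<xi>, \<eta>). (norm \<xi>)\<^sup>2 + (norm \<eta>)\<^sup>2 \<le> 1} | (lborel \<Otimes>\<^sub>M lborel).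
        case p of (\<xi>, \<eta>) \<Rightarrow>
          complex_of_real (br_weight \<delta> (1 - (norm \<xi>)\<^sup>2 - (norm \<eta>)\<^sup>2)) * fourier f \<xi> * fourier g \<eta> *
          exp (2 * complex_of_real pi * \<i> * complex_of_real (x \<bullet> (\<xi> + \<eta>))))"

text \<open>For \<open>0 < p < \<infinity>\<close>; the value is \<open>\<infinity>\<close> when \<open>f\<close> is not in \<open>L\<^sup>p\<close>. There is no real power
  on \<^typ>\<open>ennreal\<close>, hence the case distinction.\<close>

definition Lp_norm :: "real \<Rightarrow> ('a::euclidean_space \<Rightarrow> complex) \<Rightarrow> ennreal" where
  "Lp_norm p f =
     (let I = (\<integral>\<^sup>+ x. ennreal (norm (f x) powr p) \<partial>lborel)
      in if I = \<infinity> then \<infinity> else ennreal (enn2real I powr (1 / p)))"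

definition bilinear_bound ::
  "real \<Rightarrow> real \<Rightarrow> real \<Rightarrow>
   (('a::euclidean_space \<Rightarrow> complex) \<Rightarrow> ('a \<Rightarrow> complex) \<Rightarrow> 'a \<Rightarrow> complex) \<Rightarrow> real \<Rightarrow> bool" where
  "bilinear_bound p1 p2 p T C \<longleftrightarrow>
     0 \<le> C \<and>
     (\<forall>f g. schwartz f \<longrightarrow> schwartz g \<longrightarrow>
        Lp_norm p (T f g) \<le> ennreal C * Lp_norm p1 f * Lp_norm p2 g)"

definition bilinear_bounded ::
  "real \<Rightarrow> real \<Rightarrow> real \<Rightarrow>
   (('a::euclidean_space \<Rightarrow> complex) \<Rightarrow> ('a \<Rightarrow> complex) \<Rightarrow> 'a \<Rightarrow> complex) \<Rightarrow> bool" where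
  "bilinear_bounded p1 p2 p T \<longleftrightarrow> (\<exists>C. bilinear_bound p1 p2 p T C)"

text \<open>The value is \<open>\<infinity>\<close> for an unbounded operator.\<close>

definition bilinear_opnorm ::
  "real \<Rightarrow> real \<Rightarrow> real \<Rightarrow>
   (('a::euclidean_space \<Rightarrow> complex) \<Rightarrow> ('a \<Rightarrow> complex) \<Rightarrow> 'a \<Rightarrow> complex) \<Rightarrow> ennreal" where
  "bilinear_opnorm p1 p2 p T = Inf (ennreal ` {C. bilinear_bound p1 p2 p T C})"

end

theory Submission
  imports Defs "HOL-Probability.Characteristic_Functions" "HOL-Probability.Sinc_Integral"
begin

text \<open>
  Boundedness for \<open>\<delta> > 0\<close>: with \<open>a = (\<delta> - 1) / 2\<close>, the Beta integral gives
  \<open>B(a + 1, a + 1) (1 - s - t)\<^sub>+\<^sup>\<delta> = \<integral> (w - s)\<^sub>+\<^sup>a (1 - w - t)\<^sub>+\<^sup>a dw\<close>. With \<open>s = |\<xi>|\<^sup>2\<close> and \<open>t = |\<eta>|\<^sup>2\<close>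
  this writes the bilinear operator as a superposition of products \<open>A\<^sub>w f \<cdot> A\<^bsub>1-w\<^esub> g\<close> of linear multiplier
  operators. By Cauchy--Schwarz and Plancherel the bound reduces to \<open>\<integral>\<^sub>s\<^sup>1 (w - s)\<^sup>2\<^sup>a dw \<le> 1 / \<delta>\<close>, which is
  finite exactly because \<open>2 a > - 1\<close>.

  Failure for \<open>\<delta> = 0\<close>: near the point \<open>(b, b) / sqrt 2\<close> of the sphere, the ball looks like the
  half-space \<open>b \<bullet> (\<xi> + \<eta>) < 0\<close>, whose bilinear multiplier is a linear half-space multiplier applied to
  the product \<open>f g\<close>. Testing with Gaussians modulated to that point, rescaling and Fatou's lemma
  would make the half-space projection of a Gaussian integrable, although its Fourier transform is
  discontinuous.
\<close>

section \<open>Gaussians and the Plancherel inequality\<close>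

text \<open>For \<delta> < 1 the exponent a is negative, so for a fixed w > 0 the symbol of A_w is
  unbounded near the sphere |\<xi>|^2 = w and A_w is not bounded on L^2. What survives is an L^2
  estimate averaged over w. Hence Cauchy-Schwarz is applied in x and w jointly, never for one w at a
  time. Splitting \<delta> into two equal exponents gives both factors the same average, and the
  resulting constant is 1 / (\<delta> B(a + 1, a + 1)).

  In the negative part, spreading the Gaussians changes both sides of a supposed bound by the same
  power of r, so the constant stays uniform while the ball flattens into a half-space. The
  obstruction is specific to the target L^1: a half-space projection is harmless on L^2, but an
  integrable function cannot have a jump in its Fourier transform.

  Plancherel and the evaluation of the half-space transform rest on one device: insert a Gaussian
  weight so that Fubini applies, use the explicit transform of the weight, then let the weight tend
  to 1.\<close>

definition gauss :: "real \<Rightarrow> 'a::euclidean_space \<Rightarrow> real" where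
  "gauss r x = exp (- pi * (r * norm x)\<^sup>2)"

lemma gauss_pos: "0 < gauss r x"
  and gauss_nonneg [simp]: "0 \<le> gauss r x"
  and gauss_le_1: "gauss r x \<le> 1"
  and gauss_minus: "gauss r (- x) = gauss r x"
  by (simp_all add: gauss_def)

lemma gauss_measurable [measurable]: "gauss r \<in> borel_measurable borel"
  unfolding gauss_def by measurable

lemma gauss_eq_prod: "gauss r x = (\<Prod>b\<in>Basis. gauss r (x \<bullet> b))"
proof -
  have "(r * norm x)\<^sup>2 = (\<Sum>b\<in>Basis. (r * norm (x \<bullet> b))\<^sup>2)"
    unfolding power_mult_distrib power2_norm_eq_inner
    by (subst euclidean_inner) (simp add: sum_distrib_left power2_eq_square)
  then show ?thesis
    by (simp add: gauss_def exp_sum[symmetric] sum_distrib_left sum_negf)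
qed

section \<open>Integrals and Fourier transforms of Gaussians\<close>

lemma gauss_fourier_real:
  fixes t :: real
  assumes r: "0 < r"
  shows "integrable lborel (\<lambda>x::real. cis (2 * pi * (x * t)) * gauss r x)"
    and "(LINT x|lborel. cis (2 * pi * (x * t)) * gauss r x) = complex_of_real (1 / r * gauss (1 / r) t)"
proof -
  \<comment> \<open>The choice of c and u gives (c x)^2 / 2 = pi (r x)^2 and u (c x) = 2 pi x t, so
    the claim is the rescaled characteristic function of the standard normal law at u.\<close>
  define c where "c = sqrt (2 * pi) * r"
  have c: "c > 0" using r by (simp add: c_def)
  define u where "u = sqrt (2 * pi) * t / r"
  let ?f = "\<lambda>x. complex_of_real (std_normal_density x) * iexp (u * x)"
  have int0: "integrable std_normal_distribution (\<lambda>x. iexp (u * x))"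
  proof -
    interpret prob_space std_normal_distribution
      by (rule prob_space_normal_density) simp
    show ?thesis
    proof (rule integrable_const_bound[where B=1])
      show "AE x in std_normal_distribution. cmod (iexp (u * x)) \<le> 1"
        by (intro AE_I2) simp
      show "(\<lambda>x. iexp (u * x)) \<in> borel_measurable std_normal_distribution"
        by simp
    qed
  qed
  have m: "(\<lambda>x. iexp (u * x)) \<in> borel_measurable lborel" by measurable
  have n: "AE x in lborel. 0 \<le> std_normal_density x" by simp
  have d: "std_normal_density \<in> borel_measurable lborel" by measurable
  have int: "integrable lborel ?f"
    using int0 unfolding integrable_density[OF m d n] scaleR_conv_of_real .
  have val: "(LINT x|lborel. ?f x) = exp (- (u^2) / 2)"
    using fun_cong[OF char_std_normal_distribution, of u]
    unfolding char_def integral_density[OF m d n] scaleR_conv_of_real .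
  let ?g = "\<lambda>x::real. cis (2 * pi * (x * t)) * gauss r x"
  define k where "k = complex_of_real (1 / sqrt (2 * pi))"
  have k: "k \<noteq> 0" by (simp add: k_def)
  have eq: "?f (0 + c * x) = k * ?g x" for x
  proof -
    have h: "u * (0 + c * x) = 2 * pi * (x * t)"
      using r by (simp add: u_def c_def field_simps)
    have "std_normal_density (0 + c * x) = 1 / sqrt (2 * pi) * gauss r x"
      by (simp add: std_normal_density_def gauss_def c_def power_mult_distrib real_sqrt_mult)
    then have "complex_of_real (std_normal_density (0 + c * x)) = k * gauss r x"
      unfolding k_def of_real_mult[symmetric] by (rule arg_cong)
    then show ?thesis
      unfolding h cis_conv_exp by (simp only: mult_ac)
  qed
  have "integrable lborel (\<lambda>x. k * ?g x)"
    using lborel_integrable_real_affine[OF int, of c 0, OF less_imp_neq[OF c, symmetric]] unfolding eq .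
  then have "integrable lborel (\<lambda>x. (1 / k) * (k * ?g x))"
    by (rule integrable_mult_right)
  then show "integrable lborel ?g"
    using k by simp
  have "complex_of_real (exp (- (u^2) / 2)) = \<bar>c\<bar> *\<^sub>R (LINT x|lborel. ?f (0 + c * x))"
    using lborel_integral_real_affine[of c ?f 0, OF less_imp_neq[OF c, symmetric]] unfolding val .
  also have "\<dots> = of_real c * k * (LINT x|lborel. ?g x)"
    unfolding eq integral_mult_right_zero scaleR_conv_of_real using c by (simp only: abs_of_pos mult.assoc)
  also have "of_real c * k = of_real r"
    unfolding k_def of_real_mult[symmetric] by (simp add: c_def)
  finally have "(LINT x|lborel. ?g x) = exp (- (u^2) / 2) / r"
    using r by (simp add: field_simps)
  also have "exp (- (u^2) / 2) = gauss (1 / r) t"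
    by (simp add: u_def gauss_def power_divide power_mult_distrib)
  finally show "(LINT x|lborel. cis (2 * pi * (x * t)) * gauss r x) = complex_of_real (1 / r * gauss (1 / r) t)"
    by simp
qed

text \<open>Lebesgue measure is the image of the product of one-dimensional measures over
  \<open>Basis\<close>. This tensorises both the Gaussian transform and the integrable majorant for
  Schwartz functions.\<close>

lemma has_bochner_integral_lborel_prod:
  fixes f :: "'a::euclidean_space \<Rightarrow> real \<Rightarrow> complex"
  assumes "\<And>b. b \<in> Basis \<Longrightarrow> integrable lborel (f b)"
  shows "has_bochner_integral (lborel :: 'a measure) (\<lambda>x. \<Prod>b\<in>Basis. f b (x \<bullet> b))
           (\<Prod>b\<in>Basis. LINT x|lborel. f b x)"
proof -
  interpret product_sigma_finite "\<lambda>_::'a. lborel :: real measure" ..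
  have [measurable]: "\<And>b. b \<in> Basis \<Longrightarrow> f b \<in> borel_measurable borel"
    using assms by (auto dest: borel_measurable_integrable)
  have meas: "(\<lambda>x. \<Prod>b\<in>Basis. f b (x \<bullet> b)) \<in> borel_measurable (borel :: 'a measure)"
    by measurable
  have "integrable (\<Pi>\<^sub>M b\<in>Basis. lborel) (\<lambda>x. \<Prod>b\<in>(Basis::'a set). f b (x b))"
    "integral\<^sup>L (\<Pi>\<^sub>M b\<in>Basis. lborel) (\<lambda>x. \<Prod>b\<in>(Basis::'a set). f b (x b)) = (\<Prod>b\<in>Basis. LINT x|lborel. f b x)"
    using assms by (auto intro!: product_integrable_prod product_integral_prod)
  then show ?thesis
    unfolding has_bochner_integral_iff
    by (subst (1 2) lborel_eq) (simp add: integrable_distr_eq integral_distr meas cong: prod.cong)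
qed

lemma has_bochner_integral_gauss_fourier:
  fixes t :: "'a::euclidean_space"
  assumes r: "0 < r"
  shows "has_bochner_integral lborel (\<lambda>x. cis (2 * pi * (x \<bullet> t)) * gauss r x)
     (complex_of_real ((1 / r) ^ DIM('a) * gauss (1 / r) t))"
proof -
  have *: "cis (2 * pi * (x \<bullet> t)) = (\<Prod>b\<in>Basis. cis (2 * pi * ((x \<bullet> b) * (t \<bullet> b))))" for x :: 'a
    unfolding cis_conv_exp by (subst euclidean_inner)
      (simp add: exp_sum[symmetric] sum_distrib_left)
  have "has_bochner_integral lborel
     (\<lambda>x::'a. \<Prod>b\<in>Basis. cis (2 * pi * ((x \<bullet> b) * (t \<bullet> b))) * gauss r (x \<bullet> b))
     (\<Prod>b\<in>Basis. LINT x|lborel. cis (2 * pi * (x * (t \<bullet> b))) * gauss r x)"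
    using gauss_fourier_real[OF r] by (intro has_bochner_integral_lborel_prod)
  moreover have **: "gauss r x = (\<Prod>b\<in>Basis. gauss r (x \<bullet> b))" for r and x :: 'a
    by (rule gauss_eq_prod)
  ultimately show ?thesis
    unfolding * ** gauss_fourier_real(2)[OF r]
    by (simp add: prod.distrib power_divide prod_dividef)
qed

lemma gauss_integrable:
  assumes r: "0 < r"
  shows "integrable lborel (gauss r :: 'a::euclidean_space \<Rightarrow> real)"
  and "(LINT x|lborel. gauss r (x::'a)) = (1 / r) ^ DIM('a)"
proof -
  have "gauss (1 / r) (0::'a) = 1" by (simp add: gauss_def)
  then have "has_bochner_integral lborel (\<lambda>x::'a. complex_of_real (gauss r x))
      (complex_of_real ((1 / r) ^ DIM('a)))"
    using has_bochner_integral_gauss_fourier[OF r, of "0::'a"] by simp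
  then show "integrable lborel (gauss r :: 'a::euclidean_space \<Rightarrow> real)"
    "(LINT x|lborel. gauss r (x::'a)) = (1 / r) ^ DIM('a)"
    unfolding has_bochner_integral_iff complex_of_real_integrable_eq integral_complex_of_real of_real_eq_iff
    by auto
qed

section \<open>Tools for Fourier integrals: measurability, Fatou and Fubini\<close>

lemma cis_measurable [measurable]: "cis \<in> borel_measurable borel"
  by (intro borel_measurable_continuous_onI continuous_intros)

lemma cnj_measurable [measurable]: "cnj \<in> borel_measurable borel"
  by (intro borel_measurable_continuous_onI continuous_intros)

lemma fourier_cis: "fourier f \<xi> = (LINT x|lborel. cis (- (2 * pi * (x \<bullet> \<xi>))) * f x)"
  unfolding fourier_def cis_conv_exp by (simp add: mult_ac)

lemma borel_measurable_fourier [measurable]: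
  assumes [measurable]: "f \<in> borel_measurable borel"
  shows "fourier f \<in> borel_measurable borel"
  unfolding fourier_cis by measurable

lemma norm_fourier_le: "cmod (fourier f \<xi>) \<le> (LINT x|lborel. cmod (f x))"
  unfolding fourier_cis by (rule order_trans[OF integral_norm_bound]) (simp add: norm_mult)

text \<open>Integrability is not assumed: without it the Bochner integral is 0 by default and the
  bound is trivial.\<close>

lemma norm_integral_le_nn_integral:
  fixes f :: "'a \<Rightarrow> 'b::{banach, second_countable_topology}"
  shows "ennreal (norm (integral\<^sup>L M f)) \<le> (\<integral>\<^sup>+x. ennreal (norm (f x)) \<partial>M)"
  by (cases "integrable M f")
     (simp_all add: integral_norm_bound_ennreal not_integrable_integral_eq)

lemma nn_integral_lborel_shift:
  fixes c :: "'a::euclidean_space"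
  assumes [measurable]: "f \<in> borel_measurable borel"
  shows "(\<integral>\<^sup>+x. f (c + x) \<partial>lborel) = (\<integral>\<^sup>+x. f x \<partial>lborel)"
  by (subst (2) lborel_distr_plus[of c, symmetric]) (simp add: nn_integral_distr)

text \<open>Fatou's lemma in the form in which a uniform bound passes to a pointwise limit. It
  serves both for removing the weight in Plancherel and for the passage from balls to the
  half-space.\<close>

lemma nn_integral_le_of_tendsto:
  fixes u :: "nat \<Rightarrow> 'a \<Rightarrow> ennreal"
  assumes "\<And>k. u k \<in> borel_measurable M"
    and lim: "AE x in M. (\<lambda>k. u k x) \<longlonglongrightarrow> v x"
    and le: "\<And>k. (\<integral>\<^sup>+x. u k x \<partial>M) \<le> N"
  shows "(\<integral>\<^sup>+x. v x \<partial>M) \<le> N"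
proof -
  have "AE x in M. v x = liminf (\<lambda>k. u k x)"
    using lim by eventually_elim (simp add: lim_imp_Liminf)
  then have "(\<integral>\<^sup>+x. v x \<partial>M) = (\<integral>\<^sup>+x. liminf (\<lambda>k. u k x) \<partial>M)"
    by (rule nn_integral_cong_AE)
  also have "\<dots> \<le> liminf (\<lambda>k. \<integral>\<^sup>+x. u k x \<partial>M)"
    by (rule nn_integral_liminf) fact
  also have "\<dots> \<le> N"
    using Liminf_mono[of "\<lambda>k. \<integral>\<^sup>+x. u k x \<partial>M" "\<lambda>_. N" sequentially] le by (simp add: Liminf_const)
  finally show ?thesis .
qed

lemma integrable_pair_bounded:
  fixes f :: "'a::euclidean_space \<Rightarrow> complex" and g :: "'b::euclidean_space \<Rightarrow> complex"
  assumes f: "integrable lborel f" and g: "integrable lborel g"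
    and [measurable]: "k \<in> borel_measurable (borel \<Otimes>\<^sub>M borel)" and k: "\<And>p. cmod (k p) \<le> B"
  shows "integrable (lborel \<Otimes>\<^sub>M lborel) (\<lambda>(x, y). k (x, y) * f x * g y)"
proof -
  have [measurable]: "f \<in> borel_measurable borel" "g \<in> borel_measurable borel"
    using f g by (auto dest: borel_measurable_integrable)
  have "integrable (lborel \<Otimes>\<^sub>M lborel) (\<lambda>p. f (fst p) * g (snd p))"
  proof (rule lborel_pair.Fubini_integrable)
    show "integrable lborel (\<lambda>x. LINT y|lborel. cmod (f (fst (x, y)) * g (snd (x, y))))"
      using f by (simp add: norm_mult)
    show "AE x in lborel. integrable lborel (\<lambda>y. f (fst (x, y)) * g (snd (x, y)))"
      using g by simp
  qed simp
  then have "integrable (lborel \<Otimes>\<^sub>M lborel) (\<lambda>p. of_real B * (f (fst p) * g (snd p)))"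
    by (rule integrable_mult_right)
  then show ?thesis
  proof (rule Bochner_Integration.integrable_bound)
    show "(\<lambda>(x, y). k (x, y) * f x * g y) \<in> borel_measurable (lborel \<Otimes>\<^sub>M lborel)"
      by simp
    show "AE p in lborel \<Otimes>\<^sub>M lborel. cmod (case p of (x, y) \<Rightarrow> k (x, y) * f x * g y)
        \<le> cmod (of_real B * (f (fst p) * g (snd p)))"
    proof (intro AE_I2)
      fix p :: "'a \<times> 'b"
      show "cmod (case p of (x, y) \<Rightarrow> k (x, y) * f x * g y) \<le> cmod (of_real B * (f (fst p) * g (snd p)))"
        using order_trans[OF k[of p] abs_ge_self]
        by (cases p) (auto simp: norm_mult mult.assoc intro!: mult_right_mono)
    qed
  qed
qed

lemma fubini_bounded:
  fixes f :: "'a::euclidean_space \<Rightarrow> complex" and g :: "'b::euclidean_space \<Rightarrow> complex"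
  assumes "integrable lborel f" and "integrable lborel g"
    and "(\<lambda>p. k (fst p) (snd p)) \<in> borel_measurable (borel \<Otimes>\<^sub>M borel)" and "\<And>x y. cmod (k x y) \<le> B"
  shows "(LINT x|lborel. LINT y|lborel. k x y * f x * g y) = (LINT y|lborel. LINT x|lborel. k x y * f x * g y)"
  using lborel_pair.Fubini_integral[of "\<lambda>x y. k x y * f x * g y"]
    integrable_pair_bounded[OF assms(1-3), of B] assms(4) by simp

text \<open>Expanding the square and integrating the weight first turns the left side into a double
  integral of h(u), the conjugate of h(v) and a kernel W(v - u). Since W is nonnegative, even and of
  mass 1, this is a Schur test with constant 1, uniformly in r.\<close>

lemma fourier_weighted_le:
  fixes h :: "'a::euclidean_space \<Rightarrow> complex"
  assumes h: "integrable lborel h" and r: "0 < r"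
  shows "(\<integral>\<^sup>+x. ennreal (gauss r x * (cmod (fourier h x))\<^sup>2) \<partial>lborel) \<le> (\<integral>\<^sup>+x. ennreal ((cmod (h x))\<^sup>2) \<partial>lborel)"
proof -
  have [measurable]: "h \<in> borel_measurable borel"
    using h by (auto dest: borel_measurable_integrable)
  define F where "F = fourier h"
  have F_meas [measurable]: "F \<in> borel_measurable borel"
    unfolding F_def by measurable
  define B where "B = (LINT x|lborel. cmod (h x))"
  have B: "cmod (F x) \<le> B" for x unfolding F_def B_def by (rule norm_fourier_le)
  \<comment> \<open>W is the Fourier transform of the weight \<open>gauss r\<close>.\<close>
  define W where "W z = (1 / r) ^ DIM('a) * gauss (1 / r) (z :: 'a)" for z
  have [measurable]: "W \<in> borel_measurable borel" unfolding W_def by measurable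
  have W_nn: "W z \<ge> 0" for z unfolding W_def using r gauss_pos[of "1/r" z] by auto
  have W_minus: "W (- z) = W z" for z by (simp add: W_def gauss_minus)
  have W_int: "(\<integral>\<^sup>+z. ennreal (W z) \<partial>lborel) = 1"
  proof -
    have "(\<integral>\<^sup>+z. ennreal (W z) \<partial>lborel) = ennreal (LINT z|lborel. W z)"
      using gauss_integrable[of "1 / r", where 'a='a] r W_nn unfolding W_def
      by (intro nn_integral_eq_integral) auto
    also have "(LINT z|lborel. W z) = 1"
      using gauss_integrable(2)[of "1 / r", where 'a='a] r unfolding W_def by (simp add: power_divide)
    finally show ?thesis by simp
  qed
  define gc where "gc = (\<lambda>x::'a. complex_of_real (gauss r x))"
  have gc: "integrable lborel gc" using gauss_integrable(1)[OF r, where 'a='a] unfolding gc_def complex_of_real_integrable_eq by auto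
  have gint: "integrable lborel (\<lambda>x. gauss r x * (cmod (F x))\<^sup>2)"
  proof (rule Bochner_Integration.integrable_bound)
    show "integrable lborel (\<lambda>x::'a. gauss r x * B\<^sup>2)" using gauss_integrable(1)[OF r, where 'a='a] by simp
    show "AE x in lborel. norm (gauss r x * (cmod (F x))\<^sup>2) \<le> norm (gauss r x * B\<^sup>2)"
      using B by (auto simp: abs_mult intro!: AE_I2 mult_left_mono power_mono)
  qed simp
  have "(\<integral>\<^sup>+x. ennreal (gauss r x * (cmod (F x))\<^sup>2) \<partial>lborel) = ennreal (LINT x|lborel. gauss r x * (cmod (F x))\<^sup>2)"
    by (intro nn_integral_eq_integral gint) auto
  also have "(LINT x|lborel. gauss r x * (cmod (F x))\<^sup>2) =
     cmod (LINT x|lborel. complex_of_real (gauss r x * (cmod (F x))\<^sup>2))"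
    by (subst integral_complex_of_real) simp
  also have "(LINT x|lborel. complex_of_real (gauss r x * (cmod (F x))\<^sup>2)) =
      (LINT x|lborel. LINT u|lborel. (cis (- (2 * pi * (u \<bullet> x))) * cnj (F x)) * gc x * h u)"
  proof (rule Bochner_Integration.integral_cong[OF refl])
    fix x
    have "complex_of_real (gauss r x * (cmod (F x))\<^sup>2) = (cnj (F x) * gc x) * F x"
      using complex_norm_square[of "F x"] by (simp add: gc_def mult_ac)
    also have "\<dots> = (LINT u|lborel. (cnj (F x) * gc x) * (cis (- (2 * pi * (u \<bullet> x))) * h u))"
      unfolding integral_mult_right_zero F_def fourier_cis ..
    finally show "complex_of_real (gauss r x * (cmod (F x))\<^sup>2) =
      (LINT u|lborel. (cis (- (2 * pi * (u \<bullet> x))) * cnj (F x)) * gc x * h u)"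
      by (simp add: mult_ac)
  qed
  also have "\<dots> = (LINT u|lborel. LINT x|lborel. (cis (- (2 * pi * (u \<bullet> x))) * cnj (F x)) * gc x * h u)"
    by (rule fubini_bounded[OF gc h, where B=B]) (auto simp: norm_mult B)
  also have "\<dots> = (LINT u|lborel. (LINT v|lborel. cnj (h v) * W (v - u)) * h u)"
  proof (rule Bochner_Integration.integral_cong[OF refl])
    fix u
    have "(LINT x|lborel. (cis (- (2 * pi * (u \<bullet> x))) * cnj (F x)) * gc x) =
        (LINT x|lborel. LINT v|lborel. (cis (- (2 * pi * (u \<bullet> x))) * cis (2 * pi * (v \<bullet> x))) * gc x * cnj (h v))"
    proof (rule Bochner_Integration.integral_cong[OF refl])
      fix x
      have "cnj (F x) = (LINT v|lborel. cis (2 * pi * (v \<bullet> x)) * cnj (h v))"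
        unfolding F_def fourier_cis using Bochner_Integration.integral_cnj[of lborel "\<lambda>v. cis (- (2 * pi * (v \<bullet> x))) * h v"]
        by (simp add: cis_cnj)
      then show "(cis (- (2 * pi * (u \<bullet> x))) * cnj (F x)) * gc x =
        (LINT v|lborel. (cis (- (2 * pi * (u \<bullet> x))) * cis (2 * pi * (v \<bullet> x))) * gc x * cnj (h v))"
        by (simp add: mult_ac flip: integral_mult_right_zero)
    qed
    also have "\<dots> = (LINT v|lborel. LINT x|lborel. (cis (- (2 * pi * (u \<bullet> x))) * cis (2 * pi * (v \<bullet> x))) * gc x * cnj (h v))"
      by (rule fubini_bounded[OF gc, where B=1]) (use h in \<open>auto simp: norm_mult\<close>)
    also have "\<dots> = (LINT v|lborel. cnj (h v) * W (v - u))"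
    proof (rule Bochner_Integration.integral_cong[OF refl])
      fix v
      have "(LINT x|lborel. (cis (- (2 * pi * (u \<bullet> x))) * cis (2 * pi * (v \<bullet> x))) * gc x)
         = (LINT x|lborel. cis (2 * pi * (x \<bullet> (v - u))) * gauss r x)"
        unfolding gc_def cis_mult by (intro Bochner_Integration.integral_cong refl)
          (simp add: inner_diff_right inner_commute algebra_simps)
      also have "\<dots> = W (v - u)"
        using has_bochner_integral_gauss_fourier[OF r, of "v - u"] unfolding has_bochner_integral_iff W_def by simp
      finally show "(LINT x|lborel. (cis (- (2 * pi * (u \<bullet> x))) * cis (2 * pi * (v \<bullet> x))) * gc x * cnj (h v))
         = cnj (h v) * W (v - u)" by simp
    qed
    finally show "(LINT x|lborel. (cis (- (2 * pi * (u \<bullet> x))) * cnj (F x)) * gc x * h u) =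
        (LINT v|lborel. cnj (h v) * W (v - u)) * h u" by simp
  qed
  also have "ennreal (cmod \<dots>) \<le> (\<integral>\<^sup>+u. \<integral>\<^sup>+v. ennreal (cmod (h u) * cmod (h v) * W (v - u)) \<partial>lborel \<partial>lborel)"
  proof (rule order_trans[OF norm_integral_le_nn_integral], rule nn_integral_mono)
    fix u
    have "ennreal (cmod ((LINT v|lborel. cnj (h v) * W (v - u)) * h u)) =
       ennreal (cmod (h u)) * ennreal (cmod (LINT v|lborel. cnj (h v) * W (v - u)))"
      by (simp add: norm_mult ennreal_mult' mult.commute)
    also have "\<dots> \<le> ennreal (cmod (h u)) * (\<integral>\<^sup>+v. ennreal (cmod (cnj (h v) * W (v - u))) \<partial>lborel)"
      by (intro mult_left_mono norm_integral_le_nn_integral) simp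
    also have "\<dots> = (\<integral>\<^sup>+v. ennreal (cmod (h u) * cmod (h v) * W (v - u)) \<partial>lborel)"
      by (subst nn_integral_cmult[symmetric]) (auto simp: norm_mult ennreal_mult' W_nn mult.assoc)
    finally show "ennreal (cmod ((LINT v|lborel. cnj (h v) * W (v - u)) * h u)) \<le> \<dots>" .
  qed
  \<comment> \<open>By the arithmetic-geometric mean inequality the double integral splits into two
    halves. In each half the variable absent from h occurs only in W and integrates to 1.\<close>
  also have "\<dots> \<le> (\<integral>\<^sup>+u. \<integral>\<^sup>+v. (ennreal ((cmod (h u))\<^sup>2 / 2) * W (v - u) + ennreal ((cmod (h v))\<^sup>2 / 2) * W (v - u)) \<partial>lborel \<partial>lborel)"
  proof (intro nn_integral_mono)
    fix u v
    have "cmod (h u) * cmod (h v) \<le> (cmod (h u))\<^sup>2 / 2 + (cmod (h v))\<^sup>2 / 2"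
      using sum_squares_bound[of "cmod (h u)" "cmod (h v)"] by (simp add: field_simps)
    then have "cmod (h u) * cmod (h v) * W (v - u) \<le> ((cmod (h u))\<^sup>2 / 2 + (cmod (h v))\<^sup>2 / 2) * W (v - u)"
      by (intro mult_right_mono W_nn)
    then have "ennreal (cmod (h u) * cmod (h v) * W (v - u)) \<le> ennreal (((cmod (h u))\<^sup>2 / 2 + (cmod (h v))\<^sup>2 / 2) * W (v - u))"
      by (rule ennreal_leI)
    also have "\<dots> = ennreal ((cmod (h u))\<^sup>2 / 2) * W (v - u) + ennreal ((cmod (h v))\<^sup>2 / 2) * W (v - u)"
      by (simp add: ennreal_mult' W_nn flip: ennreal_plus distrib_right)
    finally show "ennreal (cmod (h u) * cmod (h v) * W (v - u)) \<le> \<dots>" .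
  qed
  also have "\<dots> = (\<integral>\<^sup>+u. \<integral>\<^sup>+v. ennreal ((cmod (h u))\<^sup>2 / 2) * W (v - u) \<partial>lborel \<partial>lborel) +
      (\<integral>\<^sup>+u. \<integral>\<^sup>+v. ennreal ((cmod (h v))\<^sup>2 / 2) * W (v - u) \<partial>lborel \<partial>lborel)"
    by (subst nn_integral_add[symmetric]) (auto intro!: nn_integral_cong nn_integral_add)
  also have "(\<integral>\<^sup>+u. \<integral>\<^sup>+v. ennreal ((cmod (h v))\<^sup>2 / 2) * W (v - u) \<partial>lborel \<partial>lborel) =
    (\<integral>\<^sup>+v. \<integral>\<^sup>+u. ennreal ((cmod (h v))\<^sup>2 / 2) * W (v - u) \<partial>lborel \<partial>lborel)"
    by (rule lborel_pair.Fubini') simp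
  also have "\<dots> = (\<integral>\<^sup>+v. \<integral>\<^sup>+u. ennreal ((cmod (h v))\<^sup>2 / 2) * W (u - v) \<partial>lborel \<partial>lborel)"
    using W_minus[of "_ - _"] by (simp add: minus_diff_eq)
  also have "(\<integral>\<^sup>+u. \<integral>\<^sup>+v. ennreal ((cmod (h u))\<^sup>2 / 2) * W (v - u) \<partial>lborel \<partial>lborel) =
      (\<integral>\<^sup>+u. ennreal ((cmod (h u))\<^sup>2 / 2) \<partial>lborel)"
    using nn_integral_lborel_shift[of W] W_int by (simp add: nn_integral_cmult nn_integral_lborel_shift[of W "- _", simplified])
  finally have "(\<integral>\<^sup>+x. ennreal (gauss r x * (cmod (F x))\<^sup>2) \<partial>lborel)
    \<le> (\<integral>\<^sup>+u. ennreal ((cmod (h u))\<^sup>2 / 2) \<partial>lborel) + (\<integral>\<^sup>+u. ennreal ((cmod (h u))\<^sup>2 / 2) \<partial>lborel)" .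
  also have "\<dots> = (\<integral>\<^sup>+u. ennreal ((cmod (h u))\<^sup>2) \<partial>lborel)"
    by (subst nn_integral_add[symmetric]) (auto intro!: nn_integral_cong simp flip: ennreal_plus)
  finally show ?thesis unfolding F_def .
qed

text \<open>The weights tend to 1 pointwise as r tends to 0, and the weighted bound does not depend
  on r.\<close>

lemma plancherel_le:
  fixes h :: "'a::euclidean_space \<Rightarrow> complex"
  assumes h: "integrable lborel h"
  shows "(\<integral>\<^sup>+x. ennreal ((cmod (fourier h x))\<^sup>2) \<partial>lborel) \<le> (\<integral>\<^sup>+x. ennreal ((cmod (h x))\<^sup>2) \<partial>lborel)"
proof (rule nn_integral_le_of_tendsto)
  have [measurable]: "h \<in> borel_measurable borel"
    using h by (auto dest: borel_measurable_integrable)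
  show "(\<lambda>x. ennreal (gauss (inverse (real (Suc k))) x * (cmod (fourier h x))\<^sup>2)) \<in> borel_measurable lborel" for k
    by measurable
  show "(\<integral>\<^sup>+x. ennreal (gauss (inverse (real (Suc k))) x * (cmod (fourier h x))\<^sup>2) \<partial>lborel) \<le>
      (\<integral>\<^sup>+x. ennreal ((cmod (h x))\<^sup>2) \<partial>lborel)" for k
    by (rule fourier_weighted_le[OF h]) simp
  have "(\<lambda>k. gauss (inverse (real (Suc k))) x * (cmod (fourier h x))\<^sup>2) \<longlonglongrightarrow>
      exp (- pi * (0 * norm x)\<^sup>2) * (cmod (fourier h x))\<^sup>2" for x
    unfolding gauss_def by (intro tendsto_intros LIMSEQ_inverse_real_of_nat)
  then show "AE x in lborel. (\<lambda>k. ennreal (gauss (inverse (real (Suc k))) x * (cmod (fourier h x))\<^sup>2)) \<longlonglongrightarrow>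
     ennreal ((cmod (fourier h x))\<^sup>2)"
    by (intro AE_I2 tendsto_ennrealI) simp
qed

section \<open>Boundedness for positive order\<close>

text \<open>The truncated power u_+^a. The guard is essential because \<open>powr\<close> is
  positive at every nonzero base, including negative ones.\<close>

definition pos_powr :: "real \<Rightarrow> real \<Rightarrow> real" where
  "pos_powr a u = (if 0 < u then u powr a else 0)"

lemma pos_powr_nonneg [simp]: "0 \<le> pos_powr a u"
  by (simp add: pos_powr_def)

lemma pos_powr_measurable [measurable]: "pos_powr a \<in> borel_measurable borel"
  unfolding pos_powr_def by measurable

text \<open>The substitution w = s + (t - s) v pulls out the power (t - s)^(2a + 1) and leaves the
  Beta integral over the unit interval. For t \<le> s the two factors have disjoint
  supports.\<close>

lemma nn_integral_pos_powr_convolution: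
  assumes a: "a > -1"
  shows "(\<integral>\<^sup>+w. ennreal (pos_powr a (w - s) * pos_powr a (t - w)) \<partial>lborel) =
    ennreal (Beta (a + 1) (a + 1) * pos_powr (2 * a + 1) (t - s))"
proof (cases "s < t")
  case True
  define c where "c = t - s"
  have c: "c > 0" using True by (simp add: c_def)
  have B_pos: "0 < Beta (a + 1) (a + 1)"
    using a by (simp add: Beta_def Gamma_real_pos)
  have unit: "(\<integral>\<^sup>+v. ennreal (pos_powr a v * pos_powr a (1 - v)) \<partial>lborel) = ennreal (Beta (a + 1) (a + 1))"
  proof (rule nn_integral_has_integral_lborel)
    have "((\<lambda>v. if v \<in> {0..1} then v powr a * (1 - v) powr a else 0) has_integral Beta (a + 1) (a + 1)) UNIV"
      using has_integral_Beta_real[of "a + 1" "a + 1"] a unfolding has_integral_restrict_UNIV by simp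
    moreover have "(\<lambda>v. if v \<in> {0..1} then v powr a * (1 - v) powr a else 0) = (\<lambda>v. pos_powr a v * pos_powr a (1 - v))"
      by (auto simp: fun_eq_iff pos_powr_def)
    ultimately show "((\<lambda>v. pos_powr a v * pos_powr a (1 - v)) has_integral Beta (a + 1) (a + 1)) UNIV"
      by simp
  qed auto
  have "pos_powr a (s + c * v - s) * pos_powr a (t - (s + c * v)) = c powr (2 * a) * (pos_powr a v * pos_powr a (1 - v))" for v
  proof -
    have "t - (s + c * v) = c * (1 - v)" by (simp add: c_def algebra_simps)
    then show ?thesis
      using c by (auto simp: pos_powr_def zero_less_mult_iff powr_mult powr_add[symmetric])
  qed
  then have "(\<integral>\<^sup>+w. ennreal (pos_powr a (w - s) * pos_powr a (t - w)) \<partial>lborel) =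
     ennreal c * (\<integral>\<^sup>+v. ennreal (c powr (2 * a)) * ennreal (pos_powr a v * pos_powr a (1 - v)) \<partial>lborel)"
    using c by (subst nn_integral_real_affine[of _ c s]) (auto simp: ennreal_mult')
  also have "\<dots> = ennreal (c * c powr (2 * a) * Beta (a + 1) (a + 1))"
    using c B_pos by (subst nn_integral_cmult, simp, subst unit, simp add: ennreal_mult mult.assoc)
  also have "c * c powr (2 * a) = c powr (2 * a + 1)"
    using c by (simp add: powr_add)
  finally show ?thesis
    using c by (simp add: pos_powr_def c_def mult.commute)
next
  case False
  then have zero: "pos_powr a (w - s) * pos_powr a (t - w) = 0" for w
    by (auto simp: pos_powr_def)
  show ?thesis unfolding zero using False by (simp add: pos_powr_def)
qed

text \<open>The cutoff w < 1 reflects the companion factor, which lives on 1 - w > 0. With s \<ge> 0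
  it confines w - s to the unit interval, and b > -1 makes the singularity at w = s
  integrable.\<close>

lemma nn_integral_pos_powr_le:
  assumes b: "b > -1" and s: "0 \<le> s"
  shows "(\<integral>\<^sup>+w. indicator {..<1} w * ennreal (pos_powr b (w - s)) \<partial>lborel) \<le> ennreal (1 / (b + 1))"
proof -
  have "(\<integral>\<^sup>+w. indicator {..<1} w * ennreal (pos_powr b (w - s)) \<partial>lborel) =
     (\<integral>\<^sup>+v. indicator {..<1} (s + v) * ennreal (pos_powr b (s + v - s)) \<partial>lborel)"
    by (rule nn_integral_lborel_shift[symmetric]) measurable
  also have "\<dots> \<le> (\<integral>\<^sup>+v. ennreal (if v \<in> {0..1} then v powr b else 0) \<partial>lborel)"
    using s by (intro nn_integral_mono) (auto simp: pos_powr_def indicator_def)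
  also have "\<dots> = ennreal (1 / (b + 1))"
  proof (rule nn_integral_has_integral_lborel)
    show "((\<lambda>v. if v \<in> {0..1} then v powr b else 0) has_integral (1 / (b + 1))) UNIV"
      using has_integral_powr_from_0[of b 1] b unfolding has_integral_restrict_UNIV by simp
  qed auto
  finally show ?thesis .
qed

section \<open>Linear operators with truncated power symbols, averaged over the level w\<close>

definition power_multiplier :: "real \<Rightarrow> real \<Rightarrow> ('a::euclidean_space \<Rightarrow> complex) \<Rightarrow> 'a \<Rightarrow> complex" where
  "power_multiplier a w h x = (LINT \<xi>|lborel. complex_of_real (pos_powr a (w - (norm \<xi>)\<^sup>2)) * h \<xi> * cis (2 * pi * (x \<bullet> \<xi>)))"

lemma integrable_cis_mult_iff:
  fixes h :: "'a::euclidean_space \<Rightarrow> complex"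
  assumes [measurable]: "h \<in> borel_measurable borel"
  shows "integrable lborel (\<lambda>\<xi>. h \<xi> * cis (t * (x \<bullet> \<xi>))) \<longleftrightarrow> integrable lborel h"
proof -
  have "integrable lborel (\<lambda>\<xi>. h \<xi> * cis (t * (x \<bullet> \<xi>))) \<longleftrightarrow> integrable lborel (\<lambda>\<xi>. cmod (h \<xi> * cis (t * (x \<bullet> \<xi>))))"
    by (rule integrable_norm_iff[symmetric]) simp
  also have "\<dots> \<longleftrightarrow> integrable lborel h"
    by (simp add: norm_mult integrable_norm_iff)
  finally show ?thesis .
qed

text \<open>Conjugation turns the inverse transform into the forward one. If h is not integrable,
  neither is any modulation of it, so the inner integral is 0 by default for every x. The estimate
  can thus be applied to singular symbols without checking integrability.\<close>

lemma inverse_fourier_plancherel_le: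
  fixes h :: "'a::euclidean_space \<Rightarrow> complex"
  assumes [measurable]: "h \<in> borel_measurable borel"
  shows "(\<integral>\<^sup>+x. ennreal ((cmod (LINT \<xi>|lborel. h \<xi> * cis (2 * pi * (x \<bullet> \<xi>))))\<^sup>2) \<partial>lborel)
    \<le> (\<integral>\<^sup>+x. ennreal ((cmod (h x))\<^sup>2) \<partial>lborel)"
proof (cases "integrable lborel h")
  case True
  have "(LINT \<xi>|lborel. h \<xi> * cis (2 * pi * (x \<bullet> \<xi>))) = cnj (fourier (\<lambda>\<xi>. cnj (h \<xi>)) x)" for x
    unfolding fourier_cis
    by (subst Bochner_Integration.integral_cnj[symmetric]) (simp add: cis_cnj inner_commute mult.commute)
  then show ?thesis
    using plancherel_le[of "\<lambda>\<xi>. cnj (h \<xi>)"] True by simp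
next
  case False
  then show ?thesis
    by (subst not_integrable_integral_eq) (simp_all add: integrable_cis_mult_iff)
qed

text \<open>For each w, Plancherel moves the squared symbol onto |h|^2. Tonelli then lets the
  w-integral act first, and it sees only (w - |\<xi>|^2)_+^(2a), whose integral over w < 1 is
  bounded uniformly in \<xi> because 2a > -1.\<close>

lemma nn_integral_power_multiplier_le:
  fixes h :: "'a::euclidean_space \<Rightarrow> complex"
  assumes [measurable]: "h \<in> borel_measurable borel" and a: "a > - 1 / 2"
  shows "(\<integral>\<^sup>+w. \<integral>\<^sup>+x. indicator {..<1} w * ennreal ((cmod (power_multiplier a w h x))\<^sup>2) \<partial>lborel \<partial>lborel)
    \<le> ennreal (1 / (2 * a + 1)) * (\<integral>\<^sup>+\<xi>. ennreal ((cmod (h \<xi>))\<^sup>2) \<partial>lborel)"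
proof -
  have le: "(\<integral>\<^sup>+x. ennreal ((cmod (power_multiplier a w h x))\<^sup>2) \<partial>lborel) \<le>
      (\<integral>\<^sup>+\<xi>. ennreal (pos_powr (2 * a) (w - (norm \<xi>)\<^sup>2)) * ennreal ((cmod (h \<xi>))\<^sup>2) \<partial>lborel)" for w
  proof -
    have "(\<integral>\<^sup>+x. ennreal ((cmod (power_multiplier a w h x))\<^sup>2) \<partial>lborel) \<le>
       (\<integral>\<^sup>+\<xi>. ennreal ((cmod (pos_powr a (w - (norm \<xi>)\<^sup>2) * h \<xi>))\<^sup>2) \<partial>lborel)"
      unfolding power_multiplier_def by (rule inverse_fourier_plancherel_le) measurable
    also have "\<dots> = (\<integral>\<^sup>+\<xi>. ennreal (pos_powr (2 * a) (w - (norm \<xi>)\<^sup>2)) * ennreal ((cmod (h \<xi>))\<^sup>2) \<partial>lborel)"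
    proof (rule nn_integral_cong)
      fix \<xi> :: 'a
      have "(pos_powr a (w - (norm \<xi>)\<^sup>2))\<^sup>2 = pos_powr (2 * a) (w - (norm \<xi>)\<^sup>2)"
        by (simp add: pos_powr_def power2_eq_square powr_add[symmetric])
      then have "(cmod (pos_powr a (w - (norm \<xi>)\<^sup>2) * h \<xi>))\<^sup>2 = pos_powr (2 * a) (w - (norm \<xi>)\<^sup>2) * (cmod (h \<xi>))\<^sup>2"
        by (simp add: norm_mult power_mult_distrib)
      then show "ennreal ((cmod (pos_powr a (w - (norm \<xi>)\<^sup>2) * h \<xi>))\<^sup>2) =
          ennreal (pos_powr (2 * a) (w - (norm \<xi>)\<^sup>2)) * ennreal ((cmod (h \<xi>))\<^sup>2)"
        by (simp only: ennreal_mult' pos_powr_nonneg)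
    qed
    finally show ?thesis .
  qed
  have "(\<integral>\<^sup>+w. \<integral>\<^sup>+x. indicator {..<1} w * ennreal ((cmod (power_multiplier a w h x))\<^sup>2) \<partial>lborel \<partial>lborel) \<le>
     (\<integral>\<^sup>+w. \<integral>\<^sup>+\<xi>. indicator {..<1} w * (ennreal (pos_powr (2 * a) (w - (norm \<xi>)\<^sup>2)) * ennreal ((cmod (h \<xi>))\<^sup>2)) \<partial>lborel \<partial>lborel)"
  proof (rule nn_integral_mono)
    fix w :: real
    have [measurable]: "power_multiplier a w h \<in> borel_measurable borel"
      unfolding power_multiplier_def by measurable
    show "(\<integral>\<^sup>+x. indicator {..<1} w * ennreal ((cmod (power_multiplier a w h x))\<^sup>2) \<partial>lborel) \<le>
       (\<integral>\<^sup>+\<xi>. indicator {..<1} w * (ennreal (pos_powr (2 * a) (w - (norm \<xi>)\<^sup>2)) * ennreal ((cmod (h \<xi>))\<^sup>2)) \<partial>lborel)"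
      by (subst (1 2) nn_integral_cmult) (auto intro!: mult_left_mono le)
  qed
  also have "\<dots> = (\<integral>\<^sup>+\<xi>. \<integral>\<^sup>+w. indicator {..<1} w * (ennreal (pos_powr (2 * a) (w - (norm \<xi>)\<^sup>2)) * ennreal ((cmod (h \<xi>))\<^sup>2)) \<partial>lborel \<partial>lborel)"
    by (rule lborel_pair.Fubini') simp
  also have "\<dots> \<le> (\<integral>\<^sup>+\<xi>. ennreal (1 / (2 * a + 1)) * ennreal ((cmod (h \<xi>))\<^sup>2) \<partial>lborel)"
  proof (rule nn_integral_mono)
    fix \<xi> :: 'a
    have "(\<integral>\<^sup>+w. indicator {..<1} w * (ennreal (pos_powr (2 * a) (w - (norm \<xi>)\<^sup>2)) * ennreal ((cmod (h \<xi>))\<^sup>2)) \<partial>lborel)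
       = (\<integral>\<^sup>+w. indicator {..<1} w * ennreal (pos_powr (2 * a) (w - (norm \<xi>)\<^sup>2)) \<partial>lborel) * ennreal ((cmod (h \<xi>))\<^sup>2)"
      by (subst nn_integral_multc[symmetric]) (auto simp: mult.assoc)
    also have "\<dots> \<le> ennreal (1 / (2 * a + 1)) * ennreal ((cmod (h \<xi>))\<^sup>2)"
      using a by (intro mult_right_mono nn_integral_pos_powr_le) auto
    finally show "(\<integral>\<^sup>+w. indicator {..<1} w * (ennreal (pos_powr (2 * a) (w - (norm \<xi>)\<^sup>2)) * ennreal ((cmod (h \<xi>))\<^sup>2)) \<partial>lborel) \<le> \<dots>" .
  qed
  also have "\<dots> = ennreal (1 / (2 * a + 1)) * (\<integral>\<^sup>+\<xi>. ennreal ((cmod (h \<xi>))\<^sup>2) \<partial>lborel)"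
    by (rule nn_integral_cmult) simp
  finally show ?thesis .
qed

section \<open>The bilinear multiplier as a superposition of products\<close>

lemma ennreal_le_of_power2_le:
  fixes x y :: ennreal
  assumes "x\<^sup>2 \<le> y\<^sup>2"
  shows "x \<le> y"
  using assms
proof (cases x; cases y)
  fix u v assume "0 \<le> u" "0 \<le> v" "x = ennreal u" "y = ennreal v"
  with assms show ?thesis
    by (simp add: ennreal_power)
qed (auto simp: ennreal_power top_unique)

lemma pair_sigma_finite_lborel3:
  "pair_sigma_finite (lborel :: real measure) (lborel \<Otimes>\<^sub>M lborel :: ('a::euclidean_space \<times> 'b::euclidean_space) measure)"
  by (simp add: pair_sigma_finite_def lborel_prod sigma_finite_lborel)

text \<open>The Beta convolution with s = |\<xi>|^2 and t = 1 - |\<eta>|^2 is inserted for the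
  multiplier, and the w-integral is pulled outside by Fubini; for fixed w the integrand separates in
  \<xi> and \<eta>. Only absolute values are kept, since Cauchy-Schwarz comes next.\<close>

lemma bilinear_multiplier_representation:
  fixes h k :: "'a::euclidean_space \<Rightarrow> complex"
  assumes [measurable]: "h \<in> borel_measurable borel" "k \<in> borel_measurable borel"
    and h: "\<And>\<xi>. cmod (h \<xi>) \<le> H" and k: "\<And>\<xi>. cmod (k \<xi>) \<le> K"
    and a: "a > - 1 / 2"
  shows "ennreal (Beta (a + 1) (a + 1)) * ennreal (cmod (LINT z|(lborel \<Otimes>\<^sub>M lborel).
       pos_powr (2 * a + 1) (1 - (norm (fst z))\<^sup>2 - (norm (snd z))\<^sup>2) * h (fst z) * k (snd z) *
       cis (2 * pi * (x \<bullet> (fst z + snd z)))))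
    \<le> (\<integral>\<^sup>+w. ennreal (cmod (power_multiplier a w h x)) * ennreal (cmod (power_multiplier a (1 - w) k x)) \<partial>lborel)"
    (is "_ * ennreal (cmod ?S) \<le> _")
proof -
  interpret P: pair_sigma_finite "lborel :: real measure" "lborel \<Otimes>\<^sub>M lborel :: ('a \<times> 'a) measure"
    by (rule pair_sigma_finite_lborel3)
  define \<beta> where "\<beta> = Beta (a + 1) (a + 1)"
  have \<beta>: "\<beta> > 0" using a by (simp add: \<beta>_def Beta_def Gamma_real_pos)
  define m where "m z = pos_powr (2 * a + 1) (1 - (norm (fst z))\<^sup>2 - (norm (snd z))\<^sup>2)" for z :: "'a \<times> 'a"
  define pp where "pp w z = pos_powr a (w - (norm (fst z))\<^sup>2) * pos_powr a (1 - (norm (snd z))\<^sup>2 - w)" for w :: real and z :: "'a \<times> 'a"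
  define e where "e z = h (fst z) * k (snd z) * cis (2 * pi * (x \<bullet> (fst z + snd z)))" for z :: "'a \<times> 'a"
  have [measurable]: "e \<in> borel_measurable (borel \<Otimes>\<^sub>M borel)" "m \<in> borel_measurable (borel \<Otimes>\<^sub>M borel)"
    unfolding e_def m_def by measurable
  have [measurable]: "(\<lambda>p. pp (fst p) (snd p)) \<in> borel_measurable (borel \<Otimes>\<^sub>M (borel \<Otimes>\<^sub>M borel))"
    unfolding pp_def by measurable
  have H: "0 \<le> H" and K: "0 \<le> K" using order_trans[OF norm_ge_zero h] order_trans[OF norm_ge_zero k] by auto
  have e: "cmod (e z) \<le> H * K" for z
    unfolding e_def by (auto simp: norm_mult intro!: mult_mono h k H)
  have pp_nn: "0 \<le> pp w z" for w z by (simp add: pp_def)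
  have int_w: "(\<integral>\<^sup>+w. ennreal (pp w z) \<partial>lborel) = ennreal (\<beta> * m z)" for z
    using nn_integral_pos_powr_convolution[of a "(norm (fst z))\<^sup>2" "1 - (norm (snd z))\<^sup>2"] a
    unfolding pp_def m_def \<beta>_def by (simp add: algebra_simps)
  have int_w': "(LINT w|lborel. pp w z) = \<beta> * m z" for z
  proof -
    have [measurable]: "(\<lambda>w. pp w z) \<in> borel_measurable borel" unfolding pp_def by measurable
    show ?thesis
      using int_w[of z] pp_nn \<beta> by (subst integral_eq_nn_integral) (auto simp: m_def)
  qed
  \<comment> \<open>The exponent 2a + 1 is positive, so the multiplier is at most 1 on its support.
    This gives the finite total mass behind the absolute integrability required by Fubini.\<close>
  have m_le: "m z \<le> indicator (cball 0 1 \<times> cball 0 1) z" for z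
  proof (cases "1 - (norm (fst z))\<^sup>2 - (norm (snd z))\<^sup>2 > 0")
    case True
    then have "(norm (fst z))\<^sup>2 \<le> 1\<^sup>2" "(norm (snd z))\<^sup>2 \<le> 1\<^sup>2"
      using zero_le_power2[of "norm (fst z)"] zero_le_power2[of "norm (snd z)"] unfolding one_power2 by linarith+
    then have "norm (fst z) \<le> 1" "norm (snd z) \<le> 1"
      using power2_le_imp_le[of _ "1::real"] by simp_all
    moreover have "m z \<le> 1"
      unfolding m_def pos_powr_def using True a by (auto intro!: powr_le1)
    ultimately show ?thesis by (cases z) simp
  next
    case False
    then show ?thesis by (simp add: m_def pos_powr_def)
  qed
  have m_fin: "(\<integral>\<^sup>+z. ennreal (m z) \<partial>(lborel \<Otimes>\<^sub>M lborel)) < \<infinity>"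
  proof -
    have "(\<integral>\<^sup>+z. ennreal (m z) \<partial>(lborel \<Otimes>\<^sub>M lborel)) \<le> (\<integral>\<^sup>+z. indicator (cball (0::'a) 1 \<times> cball (0::'a) 1) z \<partial>(lborel \<Otimes>\<^sub>M lborel))"
      unfolding ennreal_indicator[symmetric]
      by (intro nn_integral_mono ennreal_leI m_le)
    also have "\<dots> = emeasure lborel (cball (0::'a) 1) * emeasure lborel (cball (0::'a) 1)"
      by (simp add: lborel.emeasure_pair_measure_Times)
    also have "\<dots> < \<infinity>"
      using emeasure_bounded_finite[of "cball (0::'a) 1"] by (simp add: ennreal_mult_less_top)
    finally show ?thesis .
  qed
  have int: "integrable (lborel \<Otimes>\<^sub>M (lborel \<Otimes>\<^sub>M lborel)) (\<lambda>(w, z). pp w z * e z)"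
  proof (rule integrableI_bounded)
    have "(\<integral>\<^sup>+p. ennreal (norm (case p of (w, z) \<Rightarrow> pp w z * e z)) \<partial>(lborel \<Otimes>\<^sub>M (lborel \<Otimes>\<^sub>M lborel))) =
       (\<integral>\<^sup>+z. \<integral>\<^sup>+w. ennreal (norm (pp w z * e z)) \<partial>lborel \<partial>(lborel \<Otimes>\<^sub>M lborel))"
      by (subst P.nn_integral_snd[symmetric]) (simp_all add: case_prod_beta)
    also have "\<dots> \<le> (\<integral>\<^sup>+z. \<integral>\<^sup>+w. ennreal (pp w z) * ennreal (H * K) \<partial>lborel \<partial>(lborel \<Otimes>\<^sub>M lborel))"
      using e pp_nn by (intro nn_integral_mono)
        (auto simp: norm_mult ennreal_mult'[symmetric] intro!: ennreal_leI mult_left_mono mult_nonneg_nonneg H K)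
    also have "\<dots> = (\<integral>\<^sup>+z. ennreal (\<beta> * m z) * ennreal (H * K) \<partial>(lborel \<Otimes>\<^sub>M lborel))"
    proof (rule nn_integral_cong)
      fix z :: "'a \<times> 'a"
      have [measurable]: "(\<lambda>w. pp w z) \<in> borel_measurable borel" unfolding pp_def by measurable
      show "(\<integral>\<^sup>+w. ennreal (pp w z) * ennreal (H * K) \<partial>lborel) = ennreal (\<beta> * m z) * ennreal (H * K)"
        by (simp add: nn_integral_multc int_w)
    qed
    also have "\<dots> = ennreal \<beta> * (\<integral>\<^sup>+z. ennreal (m z) \<partial>(lborel \<Otimes>\<^sub>M lborel)) * ennreal (H * K)"
      using \<beta> by (simp add: nn_integral_multc ennreal_mult' nn_integral_cmult)
    also have "\<dots> < \<infinity>" using m_fin by (simp add: ennreal_mult_less_top)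
    finally show "(\<integral>\<^sup>+p. ennreal (norm (case p of (w, z) \<Rightarrow> pp w z * e z)) \<partial>(lborel \<Otimes>\<^sub>M (lborel \<Otimes>\<^sub>M lborel))) < \<infinity>" .
  qed (simp add: case_prod_beta)
  have "of_real \<beta> * ?S = (LINT z|(lborel \<Otimes>\<^sub>M lborel). LINT w|lborel. pp w z * e z)"
    unfolding integral_mult_right_zero[symmetric]
  proof (rule Bochner_Integration.integral_cong[OF refl])
    fix z :: "'a \<times> 'a"
    have "(LINT w|lborel. complex_of_real (pp w z) * e z) = complex_of_real (LINT w|lborel. pp w z) * e z"
      by simp
    also have "\<dots> = of_real \<beta> * of_real (m z) * e z"
      unfolding int_w' by simp
    finally have f: "(LINT w|lborel. complex_of_real (pp w z) * e z) = of_real \<beta> * of_real (m z) * e z" .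
    show "of_real \<beta> * (pos_powr (2 * a + 1) (1 - (norm (fst z))\<^sup>2 - (norm (snd z))\<^sup>2) * h (fst z) * k (snd z) *
       cis (2 * pi * (x \<bullet> (fst z + snd z)))) = (LINT w|lborel. pp w z * e z)"
      unfolding m_def[symmetric] f by (simp add: e_def mult_ac)
  qed
  also have "\<dots> = (LINT w|lborel. LINT z|(lborel \<Otimes>\<^sub>M lborel). pp w z * e z)"
    using P.Fubini_integral[OF int] .
  also have "\<dots> = (LINT w|lborel. power_multiplier a w h x * power_multiplier a (1 - w) k x)"
  proof (rule integral_cong_AE)
    show "(\<lambda>w. LINT z|(lborel \<Otimes>\<^sub>M lborel). pp w z * e z) \<in> borel_measurable lborel"
      by (rule borel_measurable_integrable, rule P.integrable_fst, rule int)
    have [measurable]: "(\<lambda>w. power_multiplier a w h x) \<in> borel_measurable borel" "(\<lambda>w. power_multiplier a (1 - w) k x) \<in> borel_measurable borel"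
      unfolding power_multiplier_def by measurable
    show "(\<lambda>w. power_multiplier a w h x * power_multiplier a (1 - w) k x) \<in> borel_measurable lborel"
      by simp
    \<comment> \<open>Fubini provides an integrable slice only for almost every w. On such a slice
      the character factors as well, and the integral over pairs becomes a product of two linear
      operators.\<close>
    show "AE w in lborel. (LINT z|(lborel \<Otimes>\<^sub>M lborel). pp w z * e z) = power_multiplier a w h x * power_multiplier a (1 - w) k x"
      using P.AE_integrable_fst[OF int]
    proof eventually_elim
      fix w assume *: "integrable (lborel \<Otimes>\<^sub>M lborel) (\<lambda>z. pp w z * e z)"
      define u where "u \<xi> = pos_powr a (w - (norm \<xi>)\<^sup>2) * h \<xi> * cis (2 * pi * (x \<bullet> \<xi>))" for \<xi>
      define v where "v \<eta> = pos_powr a (1 - w - (norm \<eta>)\<^sup>2) * k \<eta> * cis (2 * pi * (x \<bullet> \<eta>))" for \<eta>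
      have uv: "pp w z * e z = u (fst z) * v (snd z)" for z
        by (simp add: pp_def e_def u_def v_def inner_add_right distrib_left cis_mult[symmetric] algebra_simps)
      have "(LINT z|(lborel \<Otimes>\<^sub>M lborel). pp w z * e z) = (LINT \<xi>|lborel. LINT \<eta>|lborel. u \<xi> * v \<eta>)"
        using lborel_pair.integral_fst'[OF *] unfolding uv by simp
      also have "\<dots> = (LINT \<xi>|lborel. u \<xi>) * (LINT \<eta>|lborel. v \<eta>)"
        by simp
      finally show "(LINT z|(lborel \<Otimes>\<^sub>M lborel). pp w z * e z) = power_multiplier a w h x * power_multiplier a (1 - w) k x"
        unfolding power_multiplier_def u_def v_def .
    qed
  qed
  finally have "ennreal (cmod (of_real \<beta> * ?S)) \<le> (\<integral>\<^sup>+w. ennreal (cmod (power_multiplier a w h x * power_multiplier a (1 - w) k x)) \<partial>lborel)"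
    by (simp add: norm_integral_le_nn_integral)
  then show ?thesis
    using \<beta> unfolding \<beta>_def by (simp add: norm_mult ennreal_mult')
qed

section \<open>Integrability of Schwartz functions\<close>

lemma schwartz_continuous: "schwartz f \<Longrightarrow> continuous_on UNIV f"
  unfolding schwartz_def
  by (drule spec[of _ "[]"]) (auto simp: continuous_on_eq_continuous_within intro: differentiable_imp_continuous_within)

lemma schwartz_decay:
  assumes "schwartz f"
  obtains B where "0 < B" "\<And>x. norm x ^ k * cmod (f x) \<le> B"
proof -
  have "bounded (range (\<lambda>x. norm x ^ k *\<^sub>R f x))"
    using assms unfolding schwartz_def by (auto dest!: spec[of _ "[]"])
  then obtain B where "\<forall>x. norm (norm x ^ k *\<^sub>R f x) \<le> B" "0 < B"
    unfolding bounded_pos by auto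
  then show ?thesis by (intro that[of B]) auto
qed

lemma integrable_inverse_1_plus_square_lborel: "integrable lborel (\<lambda>x::real. 1 / (1 + x\<^sup>2))"
  using integrable_inverse_1_plus_square
  unfolding set_integrable_def by (simp add: einterval_def field_simps)

lemma prod_Basis_le_power:
  fixes x :: "'a::euclidean_space"
  shows "(\<Prod>b\<in>Basis. 1 + (x \<bullet> b)\<^sup>2) \<le> (1 + (norm x)\<^sup>2) ^ DIM('a)"
proof -
  have "(x \<bullet> b)\<^sup>2 \<le> (norm x)\<^sup>2" if "b \<in> Basis" for b
    using Basis_le_norm[OF that, of x] by (simp add: abs_le_square_iff[symmetric])
  then have "(\<Prod>b\<in>Basis. 1 + (x \<bullet> b)\<^sup>2) \<le> (\<Prod>b\<in>(Basis::'a set). 1 + (norm x)\<^sup>2)"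
    by (intro prod_mono) auto
  then show ?thesis by simp
qed

lemma schwartz_integrable:
  fixes f :: "'a::euclidean_space \<Rightarrow> complex"
  assumes f: "schwartz f"
  shows "integrable lborel f"
proof -
  define n where "n = DIM('a)"
  obtain B0 where B0: "\<And>x. norm x ^ 0 * cmod (f x) \<le> B0" "0 < B0" using schwartz_decay[OF f] by metis
  \<comment> \<open>The majorant is the tensor product of 1 / (1 + t^2). Its reciprocal is at most
    (1 + |x|^2)^n, so decay of order 2n at infinity together with boundedness suffices.\<close>
  obtain B1 where B1: "\<And>x. norm x ^ (2 * n) * cmod (f x) \<le> B1" "0 < B1" using schwartz_decay[OF f] by metis
  have "integrable (lborel :: 'a measure) (\<lambda>x. \<Prod>b\<in>Basis. complex_of_real (1 / (1 + (x \<bullet> b)\<^sup>2)))"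
    using has_bochner_integral_lborel_prod[of "\<lambda>(_ :: 'a) x. complex_of_real (1 / (1 + x\<^sup>2))"]
      integrable_inverse_1_plus_square_lborel
    unfolding has_bochner_integral_iff complex_of_real_integrable_eq by blast
  then have "integrable (lborel :: 'a measure) (\<lambda>x. of_real (2 ^ n * (B0 + B1)) * (\<Prod>b\<in>Basis. complex_of_real (1 / (1 + (x \<bullet> b)\<^sup>2))))"
    by (rule integrable_mult_right)
  then show ?thesis
  proof (rule Bochner_Integration.integrable_bound)
    show "f \<in> borel_measurable lborel"
      using schwartz_continuous[OF f] by (simp add: borel_measurable_continuous_onI)
    show "AE x in lborel. cmod (f x) \<le> cmod (of_real (2 ^ n * (B0 + B1)) * (\<Prod>b\<in>Basis. complex_of_real (1 / (1 + (x \<bullet> b)\<^sup>2))))"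
    proof (rule AE_I2)
      fix x :: 'a
      define P where "P = (\<Prod>b\<in>Basis. 1 + (x \<bullet> b)\<^sup>2)"
      have P: "P > 0" unfolding P_def by (intro prod_pos) (auto intro: add_pos_nonneg)
      have "P \<le> (1 + (norm x)\<^sup>2) ^ n" unfolding P_def n_def by (rule prod_Basis_le_power)
      also have "\<dots> \<le> (2 * max 1 ((norm x)\<^sup>2)) ^ n" by (intro power_mono) auto
      also have "\<dots> = 2 ^ n * max 1 ((norm x)\<^sup>2) ^ n" by (rule power_mult_distrib)
      also have "max 1 ((norm x)\<^sup>2) ^ n \<le> 1 + norm x ^ (2 * n)"
        by (auto simp: max_def power_mult)
      finally have "P * cmod (f x) \<le> 2 ^ n * (1 + norm x ^ (2 * n)) * cmod (f x)"
        by (simp add: mult_right_mono)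
      also have "\<dots> = 2 ^ n * (norm x ^ 0 * cmod (f x) + norm x ^ (2 * n) * cmod (f x))"
        by (simp add: algebra_simps)
      also have "\<dots> \<le> 2 ^ n * (B0 + B1)"
        by (intro mult_left_mono add_mono B0 B1) simp
      finally have "cmod (f x) \<le> 2 ^ n * (B0 + B1) * (1 / P)" using P by (simp add: field_simps)
      also have "1 / P = (\<Prod>b\<in>Basis. 1 / (1 + (x \<bullet> b)\<^sup>2))" by (simp add: P_def prod_dividef)
      also have "2 ^ n * (B0 + B1) * \<dots> = cmod (of_real (2 ^ n * (B0 + B1)) * (\<Prod>b\<in>Basis. complex_of_real (1 / (1 + (x \<bullet> b)\<^sup>2))))"
        using B0(2) B1(2) unfolding of_real_prod[symmetric] of_real_mult[symmetric] norm_of_real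
        by (subst abs_of_nonneg) (auto intro!: mult_nonneg_nonneg prod_nonneg add_nonneg_nonneg)
      finally show "cmod (f x) \<le> \<dots>" .
    qed
  qed
qed

section \<open>Norm identities and the bound for positive order\<close>

lemma Lp_norm_1: "Lp_norm 1 f = (\<integral>\<^sup>+x. ennreal (cmod (f x)) \<partial>lborel)"
  by (cases "\<integral>\<^sup>+x. ennreal (cmod (f x)) \<partial>lborel") (auto simp: Lp_norm_def)

lemma Lp_norm_2_power2: "(Lp_norm 2 f)\<^sup>2 = (\<integral>\<^sup>+x. ennreal ((cmod (f x))\<^sup>2) \<partial>lborel)"
proof (cases "\<integral>\<^sup>+x. ennreal ((cmod (f x))\<^sup>2) \<partial>lborel")
  case (real r)
  then show ?thesis
    by (simp add: Lp_norm_def ennreal_power powr_half_sqrt)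
next
  case top
  then show ?thesis by (simp add: Lp_norm_def)
qed

text \<open>The closed ball of the definition and the strict cut in \<open>pos_powr\<close> agree
  because the weight vanishes on the unit sphere when \<delta> > 0.\<close>

lemma bilinear_BR_pos_eq:
  assumes "\<delta> > 0"
  shows "bilinear_BR \<delta> f g x = (LINT z|(lborel \<Otimes>\<^sub>M lborel).
       pos_powr \<delta> (1 - (norm (fst z))\<^sup>2 - (norm (snd z))\<^sup>2) * fourier f (fst z) * fourier g (snd z) *
       cis (2 * pi * (x \<bullet> (fst z + snd z))))"
  unfolding bilinear_BR_def set_lebesgue_integral_def cis_conv_exp
  using assms by (intro Bochner_Integration.integral_cong refl)
    (auto simp: pos_powr_def br_weight_def indicator_def mult_ac)

lemma bilinear_BR_pos_le:
  fixes f g :: "'a::euclidean_space \<Rightarrow> complex"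
  assumes \<delta>: "\<delta> > 0" and f: "integrable lborel f" and g: "integrable lborel g"
  shows "ennreal (Beta ((\<delta> + 1) / 2) ((\<delta> + 1) / 2)) * Lp_norm 1 (bilinear_BR \<delta> f g)
     \<le> ennreal (1 / \<delta>) * Lp_norm 2 f * Lp_norm 2 g"
proof -
  define a where "a = (\<delta> - 1) / 2"
  have a: "a > - 1 / 2" and a1: "2 * a + 1 = \<delta>" and a2: "(\<delta> + 1) / 2 = a + 1"
    using \<delta> by (simp_all add: a_def field_simps)
  define h where "h = fourier f"
  define k where "k = fourier g"
  have [measurable]: "f \<in> borel_measurable borel" "g \<in> borel_measurable borel"
    using f g by (auto dest: borel_measurable_integrable)
  have [measurable]: "h \<in> borel_measurable borel" "k \<in> borel_measurable borel"
    unfolding h_def k_def by measurable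
  have [measurable]: "(\<lambda>x. power_multiplier a (s x) h (t x)) \<in> borel_measurable M"
     "(\<lambda>x. power_multiplier a (s x) k (t x)) \<in> borel_measurable M"
    if [measurable]: "s \<in> borel_measurable M" "t \<in> borel_measurable M" for s t and M :: "'c measure"
    unfolding power_multiplier_def by measurable
  define \<beta> where "\<beta> = Beta (a + 1) (a + 1)"
  \<comment> \<open>The cutoffs w < 1 in U and 1 - w < 1 in V cost nothing: outside 0 < w < 1 one of
    the two operators has zero symbol. They make each square integrable separately over x and
    w.\<close>
  define U where "U p = indicator {..<1} (snd p) * ennreal (cmod (power_multiplier a (snd p) h (fst p)))" for p
  define V where "V p = indicator {..<1} (1 - snd p) * ennreal (cmod (power_multiplier a (1 - snd p) k (fst p)))" for p
  have [measurable]: "U \<in> borel_measurable (borel \<Otimes>\<^sub>M borel)" "V \<in> borel_measurable (borel \<Otimes>\<^sub>M borel)"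
    unfolding U_def V_def by measurable
  have zero: "power_multiplier a w l x = 0" if "w \<le> 0" for w and l :: "'a \<Rightarrow> complex" and x
  proof -
    have "pos_powr a (w - (norm \<xi>)\<^sup>2) = 0" for \<xi> :: 'a
      using that order.strict_trans1[OF zero_le_power2, of "norm \<xi>" w] by (auto simp: pos_powr_def)
    then show ?thesis unfolding power_multiplier_def by simp
  qed
  have "ennreal \<beta> * Lp_norm 1 (bilinear_BR \<delta> f g) = (\<integral>\<^sup>+x. ennreal \<beta> * ennreal (cmod (bilinear_BR \<delta> f g x)) \<partial>lborel)"
  proof -
    interpret sigma_finite_measure "lborel \<Otimes>\<^sub>M lborel :: ('a \<times> 'a) measure"
      by (simp add: lborel_prod sigma_finite_lborel)
    have "bilinear_BR \<delta> f g \<in> borel_measurable borel"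
      unfolding bilinear_BR_pos_eq[OF \<delta>] h_def[symmetric] k_def[symmetric] by measurable
    then show ?thesis unfolding Lp_norm_1 by (intro nn_integral_cmult[symmetric]) measurable
  qed
  also have "\<dots> \<le> (\<integral>\<^sup>+x. \<integral>\<^sup>+w. U (x, w) * V (x, w) \<partial>lborel \<partial>lborel)"
  proof (rule nn_integral_mono)
    fix x :: 'a
    have "ennreal \<beta> * ennreal (cmod (bilinear_BR \<delta> f g x)) \<le>
      (\<integral>\<^sup>+w. ennreal (cmod (power_multiplier a w h x)) * ennreal (cmod (power_multiplier a (1 - w) k x)) \<partial>lborel)"
      unfolding bilinear_BR_pos_eq[OF \<delta>] \<beta>_def h_def[symmetric] k_def[symmetric]
      unfolding a1[symmetric]
      by (rule bilinear_multiplier_representation[OF _ _ _ _ a])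
         (auto simp: h_def k_def intro: norm_fourier_le)
    also have "\<dots> = (\<integral>\<^sup>+w. U (x, w) * V (x, w) \<partial>lborel)"
      by (intro nn_integral_cong) (auto simp: U_def V_def indicator_def zero)
    finally show "ennreal \<beta> * ennreal (cmod (bilinear_BR \<delta> f g x)) \<le> \<dots>" .
  qed
  also have "\<dots> = (\<integral>\<^sup>+p. U p * V p \<partial>(lborel \<Otimes>\<^sub>M lborel))"
    by (rule lborel.nn_integral_fst) measurable
  finally have le: "ennreal \<beta> * Lp_norm 1 (bilinear_BR \<delta> f g) \<le> (\<integral>\<^sup>+p. U p * V p \<partial>(lborel \<Otimes>\<^sub>M lborel))" .
  have U: "(\<integral>\<^sup>+p. (U p)\<^sup>2 \<partial>(lborel \<Otimes>\<^sub>M lborel)) \<le> ennreal (1 / \<delta>) * (Lp_norm 2 f)\<^sup>2"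
  proof -
    have "(\<integral>\<^sup>+p. (U p)\<^sup>2 \<partial>(lborel \<Otimes>\<^sub>M lborel)) = (\<integral>\<^sup>+w. \<integral>\<^sup>+x. (U (x, w))\<^sup>2 \<partial>lborel \<partial>lborel)"
      by (rule lborel_pair.nn_integral_snd[symmetric]) measurable
    also have "\<dots> = (\<integral>\<^sup>+w. \<integral>\<^sup>+x. indicator {..<1} w * ennreal ((cmod (power_multiplier a w h x))\<^sup>2) \<partial>lborel \<partial>lborel)"
      by (intro nn_integral_cong) (auto simp: U_def indicator_def ennreal_power)
    also have "\<dots> \<le> ennreal (1 / (2 * a + 1)) * (\<integral>\<^sup>+\<xi>. ennreal ((cmod (h \<xi>))\<^sup>2) \<partial>lborel)"
      by (rule nn_integral_power_multiplier_le[OF _ a]) measurable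
    also have "\<dots> \<le> ennreal (1 / \<delta>) * (Lp_norm 2 f)\<^sup>2"
      unfolding a1 Lp_norm_2_power2 h_def by (intro mult_left_mono plancherel_le f) simp
    finally show ?thesis .
  qed
  have V: "(\<integral>\<^sup>+p. (V p)\<^sup>2 \<partial>(lborel \<Otimes>\<^sub>M lborel)) \<le> ennreal (1 / \<delta>) * (Lp_norm 2 g)\<^sup>2"
  proof -
    \<comment> \<open>The reflection w -> 1 - w maps the average for V to the one already bounded
      for U.\<close>
    let ?G = "\<lambda>w. \<integral>\<^sup>+x. indicator {..<1} w * ennreal ((cmod (power_multiplier a w k x))\<^sup>2) \<partial>lborel"
    have "(\<integral>\<^sup>+p. (V p)\<^sup>2 \<partial>(lborel \<Otimes>\<^sub>M lborel)) = (\<integral>\<^sup>+w. \<integral>\<^sup>+x. (V (x, w))\<^sup>2 \<partial>lborel \<partial>lborel)"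
      by (rule lborel_pair.nn_integral_snd[symmetric]) measurable
    also have "\<dots> = (\<integral>\<^sup>+w. ?G (1 + (- 1) * w) \<partial>lborel)"
      by (intro nn_integral_cong) (auto simp: V_def indicator_def ennreal_power)
    also have "\<dots> = (\<integral>\<^sup>+w. ?G w \<partial>lborel)"
      using nn_integral_real_affine[of ?G "- 1" 1] by simp
    also have "\<dots> \<le> ennreal (1 / (2 * a + 1)) * (\<integral>\<^sup>+\<xi>. ennreal ((cmod (k \<xi>))\<^sup>2) \<partial>lborel)"
      by (rule nn_integral_power_multiplier_le[OF _ a]) measurable
    also have "\<dots> \<le> ennreal (1 / \<delta>) * (Lp_norm 2 g)\<^sup>2"
      unfolding a1 Lp_norm_2_power2 k_def by (intro mult_left_mono plancherel_le g) simp
    finally show ?thesis .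
  qed
  \<comment> \<open>Squaring avoids roots of extended reals. The two averages contribute one factor
    1 / \<delta> each, hence 1 / \<delta> after the square is removed.\<close>
  have "(ennreal \<beta> * Lp_norm 1 (bilinear_BR \<delta> f g))\<^sup>2 \<le> (\<integral>\<^sup>+p. U p * V p \<partial>(lborel \<Otimes>\<^sub>M lborel))\<^sup>2"
    using le by (intro power_mono) auto
  also have "\<dots> \<le> (\<integral>\<^sup>+p. (U p)\<^sup>2 \<partial>(lborel \<Otimes>\<^sub>M lborel)) * (\<integral>\<^sup>+p. (V p)\<^sup>2 \<partial>(lborel \<Otimes>\<^sub>M lborel))"
    by (rule Cauchy_Schwarz_nn_integral) measurable
  also have "\<dots> \<le> (ennreal (1 / \<delta>) * (Lp_norm 2 f)\<^sup>2) * (ennreal (1 / \<delta>) * (Lp_norm 2 g)\<^sup>2)"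
    by (intro mult_mono U V) auto
  also have "\<dots> = (ennreal (1 / \<delta>) * Lp_norm 2 f * Lp_norm 2 g)\<^sup>2"
    by (simp add: power2_eq_square mult_ac)
  finally show ?thesis
    unfolding \<beta>_def a2 by (rule ennreal_le_of_power2_le)
qed

text \<open>In C, the Beta value normalises the superposition, and 1 / \<delta> is the geometric
  mean of the two averaged L^2 constants.\<close>

lemma bilinear_BR_bound_of_pos:
  assumes \<delta>: "\<delta> > 0"
  defines "C \<equiv> 1 / (\<delta> * Beta ((\<delta> + 1) / 2) ((\<delta> + 1) / 2))"
  shows "bilinear_bound 2 2 1 (bilinear_BR \<delta> :: ('a::euclidean_space \<Rightarrow> complex) \<Rightarrow> _) C"
proof -
  define \<beta> where "\<beta> = Beta ((\<delta> + 1) / 2) ((\<delta> + 1) / 2)"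
  have \<beta>: "\<beta> > 0" using \<delta> by (simp add: \<beta>_def Beta_def Gamma_real_pos)
  have C: "C = 1 / \<beta> * (1 / \<delta>)" by (simp add: C_def \<beta>_def)
  have "Lp_norm 1 (bilinear_BR \<delta> f g) \<le> ennreal C * Lp_norm 2 f * Lp_norm 2 g"
    if "schwartz f" "schwartz g" for f g :: "'a \<Rightarrow> complex"
  proof -
    have "Lp_norm 1 (bilinear_BR \<delta> f g) = ennreal (1 / \<beta>) * (ennreal \<beta> * Lp_norm 1 (bilinear_BR \<delta> f g))"
      using \<beta> by (simp add: mult.assoc[symmetric] ennreal_mult'[symmetric])
    also have "\<dots> \<le> ennreal (1 / \<beta>) * (ennreal (1 / \<delta>) * Lp_norm 2 f * Lp_norm 2 g)"
      unfolding \<beta>_def using that by (intro mult_left_mono bilinear_BR_pos_le \<delta> schwartz_integrable) auto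
    also have "\<dots> = ennreal C * Lp_norm 2 f * Lp_norm 2 g"
      using \<beta> \<delta> by (simp add: C mult.assoc[symmetric] ennreal_mult'[symmetric])
    finally show ?thesis .
  qed
  moreover have "C \<ge> 0" using \<beta> \<delta> by (simp add: C)
  ultimately show ?thesis unfolding bilinear_bound_def by auto
qed

section \<open>Failure for order zero\<close>

inductive polynomial_fun :: "('a::euclidean_space \<Rightarrow> complex) \<Rightarrow> bool" where
  const: "polynomial_fun (\<lambda>x. c)"
| inner: "polynomial_fun (\<lambda>x. complex_of_real (x \<bullet> b))"
| add: "polynomial_fun p \<Longrightarrow> polynomial_fun q \<Longrightarrow> polynomial_fun (\<lambda>x. p x + q x)"
| mult: "polynomial_fun p \<Longrightarrow> polynomial_fun q \<Longrightarrow> polynomial_fun (\<lambda>x. p x * q x)"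

text \<open>The direction h is the first argument of D, so that for fixed h the derivative is again
  a polynomial in x. This is the form in which \<open>iter_partial\<close> can be iterated.\<close>

lemma polynomial_fun_has_derivative:
  "polynomial_fun p \<Longrightarrow> \<exists>D. (\<forall>x. (p has_derivative (\<lambda>h. D h x)) (at x)) \<and> (\<forall>h. polynomial_fun (D h))"
proof (induction rule: polynomial_fun.induct)
  case (const c)
  show ?case by (intro exI[of _ "\<lambda>h x. 0"]) (auto intro: polynomial_fun.const)
next
  case (inner b)
  show ?case by (intro exI[of _ "\<lambda>h x. complex_of_real (h \<bullet> b)"])
      (auto intro!: polynomial_fun.const derivative_eq_intros)
next
  case (add p q)
  then obtain D E where "\<forall>x. (p has_derivative (\<lambda>h. D h x)) (at x)" "\<forall>h. polynomial_fun (D h)"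
    "\<forall>x. (q has_derivative (\<lambda>h. E h x)) (at x)" "\<forall>h. polynomial_fun (E h)" by blast
  then show ?case
    by (intro exI[of _ "\<lambda>h x. D h x + E h x"]) (auto intro!: polynomial_fun.add has_derivative_add)
next
  case (mult p q)
  then obtain D E where "\<forall>x. (p has_derivative (\<lambda>h. D h x)) (at x)" "\<forall>h. polynomial_fun (D h)"
    "\<forall>x. (q has_derivative (\<lambda>h. E h x)) (at x)" "\<forall>h. polynomial_fun (E h)" by blast
  with mult.hyps show ?case
    by (intro exI[of _ "\<lambda>h x. p x * E h x + D h x * q x"])
      (auto intro!: polynomial_fun.add polynomial_fun.mult has_derivative_mult)
qed

lemma polynomial_fun_growth:
  "polynomial_fun p \<Longrightarrow> \<exists>K m. 0 \<le> K \<and> (\<forall>x. cmod (p x) \<le> K * (1 + norm x) ^ m)"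
proof (induction rule: polynomial_fun.induct)
  case (const c)
  show ?case by (intro exI[of _ "cmod c"] exI[of _ 0]) auto
next
  case (inner b)
  have "\<bar>x \<bullet> b\<bar> \<le> norm b * (1 + norm x)" for x
    using Cauchy_Schwarz_ineq2[of x b] by (simp add: algebra_simps add_increasing)
  then show ?case by (intro exI[of _ "norm b"] exI[of _ 1]) auto
next
  case (add p q)
  then obtain K m L l where K: "0 \<le> K" "\<And>x. cmod (p x) \<le> K * (1 + norm x) ^ m"
    and L: "0 \<le> L" "\<And>x. cmod (q x) \<le> L * (1 + norm x) ^ l" by blast
  have "cmod (p x + q x) \<le> (K + L) * (1 + norm x) ^ (m + l)" for x
  proof -
    have "K * (1 + norm x) ^ m \<le> K * (1 + norm x) ^ (m + l)" "L * (1 + norm x) ^ l \<le> L * (1 + norm x) ^ (m + l)"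
      using K(1) L(1) by (auto intro!: mult_left_mono power_increasing)
    then show ?thesis
      using K(2)[of x] L(2)[of x] norm_triangle_ineq[of "p x" "q x"] by (simp add: distrib_right)
  qed
  then show ?case using K(1) L(1) by (intro exI[of _ "K + L"] exI[of _ "m + l"]) auto
next
  case (mult p q)
  then obtain K m L l where K: "0 \<le> K" "\<And>x. cmod (p x) \<le> K * (1 + norm x) ^ m"
    and L: "0 \<le> L" "\<And>x. cmod (q x) \<le> L * (1 + norm x) ^ l" by blast
  have "cmod (p x * q x) \<le> (K * L) * (1 + norm x) ^ (m + l)" for x
  proof -
    have "cmod (p x * q x) \<le> (K * (1 + norm x) ^ m) * (L * (1 + norm x) ^ l)"
      unfolding norm_mult using K L by (intro mult_mono) auto
    then show ?thesis by (simp add: power_add mult_ac)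
  qed
  then show ?case using K(1) L(1) by (intro exI[of _ "K * L"] exI[of _ "m + l"]) auto
qed

lemma power_times_gaussian_bounded:
  assumes c: "0 < (c::real)"
  shows "\<exists>B. \<forall>t\<ge>0. (1 + t) ^ m * exp (- c * t\<^sup>2) \<le> B"
proof -
  \<comment> \<open>Raising y \<le> exp y with y = (1 + t) / M to the power M = m + 1 dominates (1 +
    t)^m by a multiple of exp (1 + t); using m + 1 keeps M nonzero. Completing the square then
    absorbs the linear exponent, at the cost 1 / (4c).\<close>
  define M where "M = real (Suc m)"
  have M: "M > 0" by (simp add: M_def)
  have "(1 + t) ^ m * exp (- c * t\<^sup>2) \<le> M ^ Suc m * exp (1 + 1 / (4 * c))" if t: "0 \<le> t" for t
  proof -
    have "(1 + t) / M \<le> exp ((1 + t) / M)" using exp_ge_add_one_self[of "(1 + t) / M"] by linarith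
    then have "((1 + t) / M) ^ Suc m \<le> exp ((1 + t) / M) ^ Suc m"
      using t M by (intro power_mono) auto
    also have "\<dots> = exp (1 + t)"
      unfolding exp_of_nat_mult[symmetric] using M by (simp add: M_def del: of_nat_Suc)
    finally have "(1 + t) ^ Suc m \<le> M ^ Suc m * exp (1 + t)"
      using M by (simp add: power_divide field_simps)
    moreover have "(1 + t) ^ m \<le> (1 + t) ^ Suc m" using t by (intro power_increasing) auto
    ultimately have "(1 + t) ^ m * exp (- c * t\<^sup>2) \<le> M ^ Suc m * exp (1 + t) * exp (- c * t\<^sup>2)"
      by (intro mult_right_mono) auto
    also have "\<dots> = M ^ Suc m * exp (1 + t - c * t\<^sup>2)"
      by (simp add: mult_exp_exp)
    also have "t - c * t\<^sup>2 \<le> 1 / (4 * c)"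
    proof -
      have "0 \<le> (2 * c * t - 1)\<^sup>2" by simp
      then show ?thesis using c by (simp add: field_simps power2_eq_square)
    qed
    then have "M ^ Suc m * exp (1 + t - c * t\<^sup>2) \<le> M ^ Suc m * exp (1 + 1 / (4 * c))"
      using M by (intro mult_left_mono) auto
    finally show ?thesis .
  qed
  then show ?thesis by blast
qed

section \<open>Modulated Gaussians as Schwartz test functions\<close>

definition modulated_gauss :: "real \<Rightarrow> 'a::euclidean_space \<Rightarrow> 'a \<Rightarrow> complex" where
  "modulated_gauss r v x = cis (2 * pi * (x \<bullet> v)) * gauss r x"

lemma modulated_gauss_exp:
  "modulated_gauss r v x = exp (complex_of_real (- pi * r\<^sup>2 * (x \<bullet> x)) + \<i> * complex_of_real (2 * pi * (x \<bullet> v)))"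
proof -
  have "- pi * (r * norm x)\<^sup>2 = - pi * r\<^sup>2 * (x \<bullet> x)"
    by (simp add: power_mult_distrib power2_norm_eq_inner)
  then show ?thesis
    unfolding modulated_gauss_def gauss_def cis_conv_exp exp_add exp_of_real by (simp only: mult.commute)
qed

lemma norm_modulated_gauss: "cmod (modulated_gauss r v x) = gauss r x"
  by (simp add: modulated_gauss_def norm_mult)

lemma polynomial_times_modulated_gauss_has_derivative:
  assumes p: "polynomial_fun p"
  shows "\<exists>q. (\<forall>x. ((\<lambda>x. p x * modulated_gauss r v x) has_derivative (\<lambda>h. q h x * modulated_gauss r v x)) (at x))
     \<and> (\<forall>h. polynomial_fun (q h))"
proof -
  obtain D where D: "\<And>x. (p has_derivative (\<lambda>h. D h x)) (at x)" "\<And>h. polynomial_fun (D h)"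
    using polynomial_fun_has_derivative[OF p] by blast
  \<comment> \<open>E h is the derivative of the complex exponent in direction h. It is affine in x,
    so differentiation only enlarges the polynomial factor.\<close>
  define E where "E h x = complex_of_real (- 2 * pi * r\<^sup>2) * complex_of_real (x \<bullet> h) + \<i> * complex_of_real (2 * pi * (h \<bullet> v))" for h x
  have E: "polynomial_fun (E h)" for h
    unfolding E_def by (intro polynomial_fun.intros)
  have "(modulated_gauss r v has_derivative (\<lambda>h. E h x * modulated_gauss r v x)) (at x)" for x
  proof -
    let ?\<theta> = "\<lambda>x. complex_of_real (- pi * r\<^sup>2 * (x \<bullet> x)) + \<i> * complex_of_real (2 * pi * (x \<bullet> v))"
    have "(?\<theta> has_derivative (\<lambda>h. E h x)) (at x)"
      by (rule derivative_eq_intros refl | simp)+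
         (auto simp: E_def fun_eq_iff inner_commute algebra_simps)
    from has_derivative_compose[OF this, of exp "(*) (exp (?\<theta> x))"]
    have "((\<lambda>x. exp (?\<theta> x)) has_derivative (\<lambda>h. E h x * exp (?\<theta> x))) (at x)"
      using DERIV_exp[of "?\<theta> x"] unfolding has_field_derivative_def by (simp add: mult.commute)
    then show ?thesis unfolding modulated_gauss_exp[abs_def] by simp
  qed
  then have "((\<lambda>x. p x * modulated_gauss r v x) has_derivative
     (\<lambda>h. p x * (E h x * modulated_gauss r v x) + D h x * modulated_gauss r v x)) (at x)" for x
    by (intro has_derivative_mult D)
  then have "((\<lambda>x. p x * modulated_gauss r v x) has_derivative
     (\<lambda>h. (p x * E h x + D h x) * modulated_gauss r v x)) (at x)" for x
    by (simp add: algebra_simps)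
  moreover have "polynomial_fun (\<lambda>x. p x * E h x + D h x)" for h
    by (intro polynomial_fun.add polynomial_fun.mult p E D)
  ultimately show ?thesis by (intro exI[of _ "\<lambda>h x. p x * E h x + D h x"]) auto
qed

lemma iter_partial_modulated_gauss:
  "\<exists>p. polynomial_fun p \<and> iter_partial bs (modulated_gauss r v) = (\<lambda>x. p x * modulated_gauss r v x)"
proof (induction bs)
  case Nil
  show ?case by (intro exI[of _ "\<lambda>x. 1"]) (auto intro: polynomial_fun.const)
next
  case (Cons b bs)
  then obtain p where p: "polynomial_fun p" "iter_partial bs (modulated_gauss r v) = (\<lambda>x. p x * modulated_gauss r v x)"
    by blast
  obtain q where q: "\<And>x. ((\<lambda>x. p x * modulated_gauss r v x) has_derivative (\<lambda>h. q h x * modulated_gauss r v x)) (at x)"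
    "\<And>h. polynomial_fun (q h)"
    using polynomial_times_modulated_gauss_has_derivative[OF p(1)] by blast
  have "iter_partial (b # bs) (modulated_gauss r v) = (\<lambda>x. q b x * modulated_gauss r v x)"
    by (simp add: p(2) frechet_derivative_at[OF q(1), symmetric])
  then show ?case using q(2) by blast
qed

lemma schwartz_modulated_gauss:
  assumes r: "0 < r"
  shows "schwartz (modulated_gauss r v)"
  unfolding schwartz_def
proof (intro allI impI conjI)
  fix bs
  obtain p where p: "polynomial_fun p" "iter_partial bs (modulated_gauss r v) = (\<lambda>x. p x * modulated_gauss r v x)"
    using iter_partial_modulated_gauss by blast
  show "iter_partial bs (modulated_gauss r v) differentiable at x" for x
    unfolding p(2) using polynomial_times_modulated_gauss_has_derivative[OF p(1), of r v] by (auto simp: differentiable_def)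
  fix k
  obtain K m where K: "0 \<le> K" "\<And>x. cmod (p x) \<le> K * (1 + norm x) ^ m"
    using polynomial_fun_growth[OF p(1)] by blast
  have "pi * r\<^sup>2 > 0" using r by simp
  from power_times_gaussian_bounded[OF this, of "k + m"] obtain B where
    B: "\<And>t. t \<ge> 0 \<Longrightarrow> (1 + t) ^ (k + m) * exp (- (pi * r\<^sup>2) * t\<^sup>2) \<le> B" by blast
  have "norm (norm x ^ k *\<^sub>R (p x * modulated_gauss r v x)) \<le> K * B" for x
  proof -
    have "norm (norm x ^ k *\<^sub>R (p x * modulated_gauss r v x)) = norm x ^ k * cmod (p x) * gauss r x"
      by (simp add: norm_mult norm_modulated_gauss)
    also have "\<dots> \<le> (1 + norm x) ^ k * (K * (1 + norm x) ^ m) * gauss r x"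
      using K by (intro mult_right_mono mult_mono power_mono) auto
    also have "\<dots> = K * ((1 + norm x) ^ (k + m) * exp (- (pi * r\<^sup>2) * (norm x)\<^sup>2))"
      by (simp add: gauss_def power_add power_mult_distrib mult_ac)
    also have "\<dots> \<le> K * B" using K by (intro mult_left_mono B) auto
    finally show ?thesis .
  qed
  then show "bounded (range (\<lambda>x. norm x ^ k *\<^sub>R iter_partial bs (modulated_gauss r v) x))"
    unfolding p(2) by (auto simp: bounded_iff)
qed

text \<open>For small r the function is spread out in space while its transform concentrates near v
  at scale r; a pair of such functions therefore probes the multiplier near (v, v).\<close>

lemma fourier_modulated_gauss:
  fixes v :: "'a::euclidean_space"
  assumes r: "0 < r"
  shows "fourier (modulated_gauss r v) \<xi> = complex_of_real ((1 / r) ^ DIM('a) * gauss (1 / r) (\<xi> - v))"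
proof -
  have "fourier (modulated_gauss r v) \<xi> = (LINT x|lborel. cis (2 * pi * (x \<bullet> (v - \<xi>))) * gauss r x)"
    unfolding fourier_cis modulated_gauss_def mult.assoc[symmetric] cis_mult
    by (intro Bochner_Integration.integral_cong refl) (simp add: inner_diff_right algebra_simps)
  also have "\<dots> = complex_of_real ((1 / r) ^ DIM('a) * gauss (1 / r) (v - \<xi>))"
    using has_bochner_integral_gauss_fourier[OF r] unfolding has_bochner_integral_iff by blast
  also have "gauss (1 / r) (v - \<xi>) = gauss (1 / r) (\<xi> - v)"
    using gauss_minus[of "1 / r" "\<xi> - v"] by simp
  finally show ?thesis .
qed

lemma Lp_norm_2_modulated_gauss:
  fixes v :: "'a::euclidean_space"
  assumes r: "0 < r"
  shows "(Lp_norm 2 (modulated_gauss r v))\<^sup>2 = ennreal ((1 / (sqrt 2 * r)) ^ DIM('a))"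
proof -
  have sq: "(gauss r x)\<^sup>2 = gauss (sqrt 2 * r) x" for x :: 'a
    by (simp add: gauss_def power_mult_distrib exp_double[symmetric])
  have "0 < sqrt 2 * r" using r by simp
  note g = gauss_integrable[OF this, where 'a='a]
  show ?thesis
    unfolding Lp_norm_2_power2 norm_modulated_gauss sq g(2)[symmetric]
    by (rule nn_integral_eq_integral[OF g(1)]) simp
qed

section \<open>Rescaled Gaussian tests: from the ball to the half-space\<close>

lemma nn_integral_lborel_affine:
  fixes t :: "'a::euclidean_space"
  assumes [measurable]: "f \<in> borel_measurable borel" and c: "c \<noteq> 0"
  shows "(\<integral>\<^sup>+x. f x \<partial>lborel) = ennreal (\<bar>c\<bar> ^ DIM('a)) * (\<integral>\<^sup>+x. f (t + c *\<^sub>R x) \<partial>lborel)"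
  by (subst lborel_affine[OF c, of t])
     (simp add: nn_integral_density nn_integral_distr nn_integral_cmult)

lemma integral_lborel_affine:
  fixes f :: "'a::euclidean_space \<Rightarrow> complex" and t :: 'a
  assumes [measurable]: "f \<in> borel_measurable borel" and c: "c \<noteq> 0"
  shows "(LINT x|lborel. f x) = of_real (\<bar>c\<bar> ^ DIM('a)) * (LINT x|lborel. f (t + c *\<^sub>R x))"
  by (subst lborel_affine[OF c, of t])
     (simp add: integral_density integral_distr scaleR_conv_of_real)

lemma AE_inner_neq_0:
  fixes p :: "'a::euclidean_space"
  assumes "p \<noteq> 0"
  shows "AE z in lborel. p \<bullet> z \<noteq> 0"
proof -
  have "{z. p \<bullet> z = 0} \<in> null_sets lebesgue"
    using negligible_hyperplane[of p 0] assms by (simp add: negligible_iff_null_sets)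
  moreover have "{z. p \<bullet> z = 0} \<in> sets lborel" by simp
  ultimately have "{z. p \<bullet> z = 0} \<in> null_sets lborel"
    by (simp add: null_sets_completion_iff)
  from AE_not_in[OF this] show ?thesis by simp
qed

text \<open>With z = (\<xi>, \<eta>) the phase is y \<bullet> (\<xi> + \<eta>), and
  \<open>gauss 1\<close> is its own Fourier transform. This is therefore the bilinear operator with
  multiplier the indicator of D, applied to two standard Gaussians.\<close>

definition gauss_cut :: "('a \<times> 'a) set \<Rightarrow> 'a::euclidean_space \<Rightarrow> complex" where
  "gauss_cut D y = (LINT z|lborel. indicator D z * (cis (2 * pi * (z \<bullet> (y, y))) * gauss 1 z))"

lemma gauss_cut_UNIV: "gauss_cut UNIV y = complex_of_real (gauss (sqrt 2) y)"
proof -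
  have "(LINT z|lborel. cis (2 * pi * (z \<bullet> (y, y))) * gauss 1 z) = complex_of_real (gauss 1 (y, y))"
    using has_bochner_integral_gauss_fourier[of 1 "(y, y)"] unfolding has_bochner_integral_iff by simp
  also have "gauss 1 (y, y) = gauss (sqrt 2) y"
    by (simp add: gauss_def norm_Pair power_mult_distrib)
  finally show ?thesis by (simp add: gauss_cut_def)
qed

lemma integrable_gauss_cut_integrand:
  fixes y :: "'a::euclidean_space"
  assumes [measurable]: "D \<in> sets borel"
  shows "integrable lborel (\<lambda>z. indicator D z * (cis (2 * pi * (z \<bullet> (y, y))) * gauss 1 z))"
proof (rule Bochner_Integration.integrable_bound)
  show "integrable lborel (\<lambda>z :: 'a \<times> 'a. gauss 1 z)" by (rule gauss_integrable) simp
qed (auto simp: norm_mult indicator_def)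

lemma gauss_cut_measurable:
  fixes D :: "('a::euclidean_space \<times> 'a) set"
  assumes [measurable]: "D \<in> sets borel"
  shows "gauss_cut D \<in> borel_measurable borel"
proof -
  have [measurable]: "(\<lambda>y::'a. (y, y)) \<in> borel_measurable borel"
    by (intro borel_measurable_continuous_onI continuous_intros)
  show ?thesis unfolding gauss_cut_def by measurable
qed

text \<open>Conjugation amounts to the reflection z -> -z, which exchanges the two open half-spaces.
  Together they fill the space up to a null hyperplane, so the sum is the uncut product of
  Gaussians.\<close>

lemma gauss_cut_halfspace_real_part:
  fixes p :: "'a::euclidean_space \<times> 'a"
  assumes p: "p \<noteq> 0"
  shows "gauss_cut {z. p \<bullet> z < 0} y + cnj (gauss_cut {z. p \<bullet> z < 0} y) = complex_of_real (gauss (sqrt 2) y)"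
proof -
  let ?D = "{z. p \<bullet> z < 0}" and ?E = "{z. p \<bullet> z > 0}"
  have m [measurable]: "?D \<in> sets borel" "?E \<in> sets borel" by auto
  have "cnj (gauss_cut ?D y) = (LINT z|lborel. indicator ?D z * (cis (- (2 * pi * (z \<bullet> (y, y)))) * gauss 1 z))"
    unfolding gauss_cut_def
    by (subst Bochner_Integration.integral_cnj[symmetric]) (auto intro!: Bochner_Integration.integral_cong simp: cis_cnj indicator_def)
  also have "\<dots> = (LINT z|lborel. indicator ?D (0 + (- 1) *\<^sub>R z) * (cis (- (2 * pi * ((0 + (- 1) *\<^sub>R z) \<bullet> (y, y)))) * gauss 1 (0 + (- 1) *\<^sub>R z)))"
    by (subst integral_lborel_affine[of _ "- 1" 0]) auto
  also have "\<dots> = gauss_cut ?E y"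
    unfolding gauss_cut_def by (intro Bochner_Integration.integral_cong refl) (auto simp: indicator_def gauss_minus)
  finally have "gauss_cut ?D y + cnj (gauss_cut ?D y) = gauss_cut ?D y + gauss_cut ?E y" by simp
  also have "\<dots> = (LINT z|lborel. indicator ?D z * (cis (2 * pi * (z \<bullet> (y, y))) * gauss 1 z) +
      indicator ?E z * (cis (2 * pi * (z \<bullet> (y, y))) * gauss 1 z))"
    unfolding gauss_cut_def
    by (intro Bochner_Integration.integral_add[symmetric] integrable_gauss_cut_integrand m)
  also have "\<dots> = gauss_cut UNIV y"
    unfolding gauss_cut_def
  proof (rule integral_cong_AE)
    show "AE z in lborel. indicator ?D z * (cis (2 * pi * (z \<bullet> (y, y))) * complex_of_real (gauss 1 z)) +
       indicator ?E z * (cis (2 * pi * (z \<bullet> (y, y))) * complex_of_real (gauss 1 z)) =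
       indicator UNIV z * (cis (2 * pi * (z \<bullet> (y, y))) * complex_of_real (gauss 1 z))"
      using AE_inner_neq_0[OF p] by eventually_elim (auto simp: indicator_def)
  qed auto
  finally show ?thesis unfolding gauss_cut_UNIV .
qed

text \<open>After modulation to the point \<open>(b, b) / sqrt 2\<close> of the sphere and rescaling by \<open>r\<close>, the unit ball
  becomes a ball touching the hyperplane \<open>(b, b) \<bullet> z = 0\<close> at the origin.\<close>

lemma bilinear_BR_0_modulated_gauss:
  fixes b :: "'a::euclidean_space"
  assumes b: "norm b = 1" and r: "0 < r"
  defines "v \<equiv> (1 / sqrt 2) *\<^sub>R b"
  shows "bilinear_BR 0 (modulated_gauss r v) (modulated_gauss r v) x =
     cis (2 * pi * ((v, v) \<bullet> (x, x))) * gauss_cut {z. 2 * ((v, v) \<bullet> z) + r * (norm z)\<^sup>2 \<le> 0} (r *\<^sub>R x)"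
proof -
  let ?n = "DIM('a)"
  have v1: "norm (v, v) = 1"
    using b by (simp add: v_def norm_Pair power_divide)
  \<comment> \<open>F is the joint transform of the two test functions; its amplitude (1 / r)^(2n)
    is chosen by the transform and will cancel the Jacobian of z -> (v, v) + r z.\<close>
  define F where "F z = (1 / r) ^ (2 * ?n) * gauss (1 / r) (z - (v, v))" for z :: "'a \<times> 'a"
  have F: "fourier (modulated_gauss r v) \<xi> * fourier (modulated_gauss r v) \<eta> = complex_of_real (F (\<xi>, \<eta>))" for \<xi> \<eta>
  proof -
    have "gauss (1 / r) (\<xi> - v) * gauss (1 / r) (\<eta> - v) = gauss (1 / r) ((\<xi>, \<eta>) - (v, v))"
      by (simp add: gauss_def norm_Pair power_mult_distrib power_divide add_divide_distrib mult_exp_exp algebra_simps)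
    then show ?thesis
      unfolding fourier_modulated_gauss[OF r] F_def of_real_mult[symmetric]
      by (simp add: mult_2_right power_add mult_ac)
  qed
  have [measurable]: "F \<in> borel_measurable borel" unfolding F_def by measurable
  have "bilinear_BR 0 (modulated_gauss r v) (modulated_gauss r v) x =
     (LINT z|lborel. indicator (cball 0 1) z * (F z * cis (2 * pi * (z \<bullet> (x, x)))))"
    unfolding bilinear_BR_def set_lebesgue_integral_def lborel_prod
  proof (rule Bochner_Integration.integral_cong[OF refl])
    fix z :: "'a \<times> 'a"
    obtain \<xi> \<eta> where z: "z = (\<xi>, \<eta>)" by (cases z)
    have "(norm \<xi>)\<^sup>2 + (norm \<eta>)\<^sup>2 = (norm z)\<^sup>2" by (simp add: z norm_Pair)
    then have "(z \<in> {(\<xi>, \<eta>). (norm \<xi>)\<^sup>2 + (norm \<eta>)\<^sup>2 \<le> 1}) = (z \<in> cball 0 1)"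
      using abs_square_le_1[of "norm z"] by (simp add: z)
    then have ind: "indicator {(\<xi>, \<eta>). (norm \<xi>)\<^sup>2 + (norm \<eta>)\<^sup>2 \<le> 1} z = (indicator (cball 0 1) z :: real)"
      by (simp only: indicator_def)
    have "x \<bullet> (\<xi> + \<eta>) = z \<bullet> (x, x)" by (simp add: z inner_add_right inner_commute)
    then have "exp (2 * complex_of_real pi * \<i> * complex_of_real (x \<bullet> (\<xi> + \<eta>))) = cis (2 * pi * (z \<bullet> (x, x)))"
      by (simp add: cis_conv_exp mult_ac)
    then show "indicator {(\<xi>, \<eta>). (norm \<xi>)\<^sup>2 + (norm \<eta>)\<^sup>2 \<le> 1} z *\<^sub>R (case z of (\<xi>, \<eta>) \<Rightarrow>
        complex_of_real (br_weight 0 (1 - (norm \<xi>)\<^sup>2 - (norm \<eta>)\<^sup>2)) * fourier (modulated_gauss r v) \<xi> *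
          fourier (modulated_gauss r v) \<eta> * exp (2 * complex_of_real pi * \<i> * complex_of_real (x \<bullet> (\<xi> + \<eta>)))) =
       indicator (cball 0 1) z * (F z * cis (2 * pi * (z \<bullet> (x, x))))"
      unfolding ind by (simp add: z br_weight_def F indicator_def)
  qed
  also have "\<dots> = of_real (r ^ (2 * ?n)) * (LINT z|lborel. indicator (cball 0 1) ((v, v) + r *\<^sub>R z) *
      (F ((v, v) + r *\<^sub>R z) * cis (2 * pi * (((v, v) + r *\<^sub>R z) \<bullet> (x, x)))))"
  proof -
    have dim: "\<bar>r\<bar> ^ DIM('a \<times> 'a) = r ^ (2 * ?n)" using r by (simp add: mult_2)
    have [measurable]: "cball (0 :: 'a \<times> 'a) 1 \<in> sets borel" by simp
    have [measurable]: "(\<lambda>z. z \<bullet> (x, x)) \<in> borel_measurable borel"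
      by (intro borel_measurable_continuous_onI continuous_intros)
    have "(\<lambda>z. indicator (cball 0 1) z * (F z * cis (2 * pi * (z \<bullet> (x, x))))) \<in> borel_measurable borel"
      by measurable
    from integral_lborel_affine[OF this less_imp_neq[OF r, symmetric], of "(v, v)"]
    show ?thesis unfolding dim .
  qed
  also have "\<dots> = (LINT z|lborel. cis (2 * pi * ((v, v) \<bullet> (x, x))) *
      (indicator {z. 2 * ((v, v) \<bullet> z) + r * (norm z)\<^sup>2 \<le> 0} z * (cis (2 * pi * (z \<bullet> (r *\<^sub>R x, r *\<^sub>R x))) * gauss 1 z)))"
    unfolding integral_mult_right_zero[symmetric]
  proof (rule Bochner_Integration.integral_cong[OF refl])
    fix z :: "'a \<times> 'a"
    have "r ^ (2 * ?n) * F ((v, v) + r *\<^sub>R z) = gauss 1 z"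
      using r by (simp add: F_def gauss_def power_divide)
    then have 1: "complex_of_real (r ^ (2 * ?n)) * complex_of_real (F ((v, v) + r *\<^sub>R z)) = complex_of_real (gauss 1 z)"
      unfolding of_real_mult[symmetric] by (rule arg_cong)
    have "2 * pi * (((v, v) + r *\<^sub>R z) \<bullet> (x, x)) = 2 * pi * ((v, v) \<bullet> (x, x)) + 2 * pi * (z \<bullet> (r *\<^sub>R x, r *\<^sub>R x))"
      by (cases z) (simp add: algebra_simps inner_add_left)
    then have 2: "cis (2 * pi * (((v, v) + r *\<^sub>R z) \<bullet> (x, x))) = cis (2 * pi * ((v, v) \<bullet> (x, x))) * cis (2 * pi * (z \<bullet> (r *\<^sub>R x, r *\<^sub>R x)))"
      by (simp only: cis_mult)
    \<comment> \<open>Because |(v, v)| = 1, the constant term cancels in the ball condition and a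
      factor r > 0 can be divided out. The curvature term that remains carries a factor r and
      disappears in the limit.\<close>
    have "(norm ((v, v) + r *\<^sub>R z))\<^sup>2 = 1 + r * (2 * ((v, v) \<bullet> z) + r * (norm z)\<^sup>2)"
      unfolding power2_norm_eq_inner using v1
      by (simp add: inner_add_left inner_add_right norm_eq_1 inner_commute algebra_simps power2_eq_square)
    then have "norm ((v, v) + r *\<^sub>R z) \<le> 1 \<longleftrightarrow> 2 * ((v, v) \<bullet> z) + r * (norm z)\<^sup>2 \<le> 0"
      using r abs_le_square_iff[of "norm ((v, v) + r *\<^sub>R z)" 1] by (simp add: mult_le_0_iff)
    then have 3: "indicator (cball 0 1) ((v, v) + r *\<^sub>R z) = (indicator {z. 2 * ((v, v) \<bullet> z) + r * (norm z)\<^sup>2 \<le> 0} z :: complex)"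
      by (simp add: indicator_def)
    show "complex_of_real (r ^ (2 * ?n)) * (indicator (cball 0 1) ((v, v) + r *\<^sub>R z) *
      (complex_of_real (F ((v, v) + r *\<^sub>R z)) * cis (2 * pi * (((v, v) + r *\<^sub>R z) \<bullet> (x, x))))) =
      cis (2 * pi * ((v, v) \<bullet> (x, x))) *
      (indicator {z. 2 * ((v, v) \<bullet> z) + r * (norm z)\<^sup>2 \<le> 0} z * (cis (2 * pi * (z \<bullet> (r *\<^sub>R x, r *\<^sub>R x))) * gauss 1 z))"
      unfolding 2 3 1[symmetric] by (simp only: mult_ac)
  qed
  also have "\<dots> = cis (2 * pi * ((v, v) \<bullet> (x, x))) * gauss_cut {z. 2 * ((v, v) \<bullet> z) + r * (norm z)\<^sup>2 \<le> 0} (r *\<^sub>R x)"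
    unfolding gauss_cut_def by (rule integral_mult_right_zero)
  finally show ?thesis .
qed

text \<open>The substitution y = r x contributes r^n, and the product of the two L^2 norms
  contributes (sqrt 2 r)^(-n). The powers of r cancel, so the bound survives r -> 0.\<close>

lemma gauss_cut_ball_norm_le:
  fixes b :: "'a::euclidean_space"
  assumes bound: "bilinear_bound 2 2 1 (bilinear_BR 0 :: ('a \<Rightarrow> complex) \<Rightarrow> _) C"
    and b: "norm b = 1" and r: "0 < r"
  defines "v \<equiv> (1 / sqrt 2) *\<^sub>R b"
  shows "(\<integral>\<^sup>+y. ennreal (cmod (gauss_cut {z. 2 * ((v, v) \<bullet> z) + r * (norm z)\<^sup>2 \<le> 0} y)) \<partial>lborel)
     \<le> ennreal (C * (1 / sqrt 2) ^ DIM('a))"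
proof -
  let ?f = "modulated_gauss r v"
  define D where "D = {z. 2 * ((v, v) \<bullet> z) + r * (norm z)\<^sup>2 \<le> 0}"
  have [measurable]: "D \<in> sets borel" unfolding D_def by measurable
  have [measurable]: "gauss_cut D \<in> borel_measurable borel" by (rule gauss_cut_measurable) measurable
  have C: "C \<ge> 0" using bound unfolding bilinear_bound_def by blast
  have "(\<integral>\<^sup>+y. ennreal (cmod (gauss_cut D y)) \<partial>lborel) = ennreal (r ^ DIM('a)) * (\<integral>\<^sup>+x. ennreal (cmod (gauss_cut D (0 + r *\<^sub>R x))) \<partial>lborel)"
    using r by (subst nn_integral_lborel_affine[of _ r 0]) auto
  also have "(\<integral>\<^sup>+x. ennreal (cmod (gauss_cut D (0 + r *\<^sub>R x))) \<partial>lborel) = Lp_norm 1 (bilinear_BR 0 ?f ?f)"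
    unfolding Lp_norm_1 v_def bilinear_BR_0_modulated_gauss[OF b r]
    unfolding v_def[symmetric] D_def by (simp add: norm_mult)
  also have "\<dots> \<le> ennreal C * Lp_norm 2 ?f * Lp_norm 2 ?f"
    using bound schwartz_modulated_gauss[OF r, of v] unfolding bilinear_bound_def by blast
  also have "\<dots> = ennreal C * ennreal ((1 / (sqrt 2 * r)) ^ DIM('a))"
    using Lp_norm_2_modulated_gauss[OF r, of v] by (simp add: power2_eq_square mult.assoc)
  finally have "(\<integral>\<^sup>+y. ennreal (cmod (gauss_cut D y)) \<partial>lborel) \<le>
     ennreal (r ^ DIM('a)) * (ennreal C * ennreal ((1 / (sqrt 2 * r)) ^ DIM('a)))"
    by (simp add: mult_left_mono)
  also have "\<dots> = ennreal (r ^ DIM('a) * (C * (1 / (sqrt 2 * r)) ^ DIM('a)))"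
    using r C by (simp add: ennreal_mult')
  also have "r ^ DIM('a) * (C * (1 / (sqrt 2 * r)) ^ DIM('a)) = C * (1 / sqrt 2) ^ DIM('a)"
    using r by (simp add: power_divide power_mult_distrib)
  finally show ?thesis unfolding D_def .
qed

text \<open>The indicators of the flattening balls are eventually equal to that of the open
  half-space at every z \<noteq> 0, and \<open>gauss 1\<close> is an integrable majorant.\<close>

lemma gauss_cut_ball_tendsto:
  fixes v :: "'a::euclidean_space"
  shows "(\<lambda>k. gauss_cut {z. 2 * ((v, v) \<bullet> z) + inverse (real (Suc k)) * (norm z)\<^sup>2 \<le> 0} y)
     \<longlonglongrightarrow> gauss_cut {z. (v, v) \<bullet> z < 0} y"
  unfolding gauss_cut_def
proof (rule integral_dominated_convergence)
  show "integrable lborel (\<lambda>z :: 'a \<times> 'a. gauss 1 z)" by (rule gauss_integrable) simp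
  have "AE z in lborel. (z :: 'a \<times> 'a) \<noteq> 0" by (rule AE_lborel_singleton)
  then show "AE z in lborel. (\<lambda>k. indicator {z. 2 * ((v, v) \<bullet> z) + inverse (real (Suc k)) * (norm z)\<^sup>2 \<le> 0} z *
       (cis (2 * pi * (z \<bullet> (y, y))) * complex_of_real (gauss 1 z)))
      \<longlonglongrightarrow> indicator {z. (v, v) \<bullet> z < 0} z * (cis (2 * pi * (z \<bullet> (y, y))) * complex_of_real (gauss 1 z))"
  proof eventually_elim
    fix z :: "'a \<times> 'a" assume z: "z \<noteq> 0"
    have lim: "(\<lambda>k. 2 * ((v, v) \<bullet> z) + inverse (real (Suc k)) * (norm z)\<^sup>2) \<longlonglongrightarrow> 2 * ((v, v) \<bullet> z) + 0 * (norm z)\<^sup>2"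
      by (intro tendsto_intros LIMSEQ_inverse_real_of_nat)
    have "\<forall>\<^sub>F k in sequentially. (2 * ((v, v) \<bullet> z) + inverse (real (Suc k)) * (norm z)\<^sup>2 \<le> 0) = ((v, v) \<bullet> z < 0)"
    proof (cases "(v, v) \<bullet> z < 0")
      case True
      then have "2 * ((v, v) \<bullet> z) + 0 * (norm z)\<^sup>2 < 0" by simp
      from order_tendstoD(2)[OF lim this] show ?thesis
        by eventually_elim (use True in auto)
    next
      case False
      \<comment> \<open>For z on the hyperplane or beyond it, the curvature term is strictly
        positive for every k, so z lies in none of the balls.\<close>
      have "inverse (real (Suc k)) * (norm z)\<^sup>2 > 0" for k using z by simp
      then have "\<not> 2 * ((v, v) \<bullet> z) + inverse (real (Suc k)) * (norm z)\<^sup>2 \<le> 0" for k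
        using False by (smt (verit))
      then show ?thesis using False by simp
    qed
    then have "\<forall>\<^sub>F k in sequentially. indicator {z. 2 * ((v, v) \<bullet> z) + inverse (real (Suc k)) * (norm z)\<^sup>2 \<le> 0} z *
       (cis (2 * pi * (z \<bullet> (y, y))) * complex_of_real (gauss 1 z)) =
       indicator {z. (v, v) \<bullet> z < 0} z * (cis (2 * pi * (z \<bullet> (y, y))) * complex_of_real (gauss 1 z))"
      by eventually_elim (simp add: indicator_def)
    then show "(\<lambda>k. indicator {z. 2 * ((v, v) \<bullet> z) + inverse (real (Suc k)) * (norm z)\<^sup>2 \<le> 0} z *
       (cis (2 * pi * (z \<bullet> (y, y))) * complex_of_real (gauss 1 z)))
      \<longlonglongrightarrow> indicator {z. (v, v) \<bullet> z < 0} z * (cis (2 * pi * (z \<bullet> (y, y))) * complex_of_real (gauss 1 z))"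
      by (rule tendsto_eventually)
  qed
qed (auto simp: norm_mult indicator_def)

section \<open>The Fourier transform of the half-space limit\<close>

lemma power_times_gaussian_tendsto_0:
  assumes c: "0 < (c::real)"
  shows "(\<lambda>k. real (Suc k) ^ n * exp (- c * (real (Suc k))\<^sup>2)) \<longlonglongrightarrow> 0"
proof (rule tendsto_sandwich[OF _ _ tendsto_const])
  have "filterlim (\<lambda>k. c * real (Suc k)) at_top sequentially"
    using c by (intro filterlim_tendsto_pos_mult_at_top[OF tendsto_const] filterlim_compose[OF filterlim_real_sequentially filterlim_Suc])
  then have "(\<lambda>k. (c * real (Suc k)) ^ n / exp (c * real (Suc k))) \<longlonglongrightarrow> 0"
    by (rule filterlim_compose[OF tendsto_power_div_exp_0])
  then have "(\<lambda>k. 1 / c ^ n * ((c * real (Suc k)) ^ n / exp (c * real (Suc k)))) \<longlonglongrightarrow> 1 / c ^ n * 0"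
    by (intro tendsto_intros)
  then show "(\<lambda>k. 1 / c ^ n * ((c * real (Suc k)) ^ n / exp (c * real (Suc k)))) \<longlonglongrightarrow> 0" by simp
  show "\<forall>\<^sub>F k in sequentially. real (Suc k) ^ n * exp (- c * (real (Suc k))\<^sup>2) \<le> 1 / c ^ n * ((c * real (Suc k)) ^ n / exp (c * real (Suc k)))"
  proof (rule always_eventually, rule allI)
    fix k
    have "real (Suc k) \<le> (real (Suc k))\<^sup>2" by (rule self_le_power) auto
    then have "exp (- c * (real (Suc k))\<^sup>2) \<le> exp (- (c * real (Suc k)))" using c by simp
    then have "real (Suc k) ^ n * exp (- c * (real (Suc k))\<^sup>2) \<le> real (Suc k) ^ n * exp (- (c * real (Suc k)))"
      by (intro mult_left_mono) auto
    also have "\<dots> = 1 / c ^ n * ((c * real (Suc k)) ^ n / exp (c * real (Suc k)))"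
      using c by (simp add: exp_minus power_mult_distrib field_simps del: of_nat_Suc)
    finally show "real (Suc k) ^ n * exp (- c * (real (Suc k))\<^sup>2) \<le> \<dots>" .
  qed
qed auto

text \<open>The frequencies \<xi> + \<eta> that enter satisfy v \<bullet> (\<xi> + \<eta>) < 0,
  whereas s v lies on the other side at distance s |v| from that half-space. A Gaussian factor of
  parameter \<rho> in y blurs frequencies at scale \<rho> only, so the regularised integral decays
  faster than any power of \<rho>.\<close>

lemma integral_gauss_cut_halfspace_eq_0:
  fixes v :: "'a::euclidean_space"
  assumes v: "v \<noteq> 0" and s: "0 < s"
    and T: "integrable lborel (gauss_cut {z. (v, v) \<bullet> z < 0})"
  shows "(LINT y|lborel. gauss_cut {z. (v, v) \<bullet> z < 0} y * cis (- (2 * pi * s * (y \<bullet> v)))) = 0"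
proof -
  let ?n = "DIM('a)"
  define D where "D = {z. (v, v) \<bullet> z < 0}"
  have D [measurable]: "D \<in> sets borel" unfolding D_def by simp
  note T' = T[folded D_def]
  have [measurable]: "gauss_cut D \<in> borel_measurable borel"
    by (rule gauss_cut_measurable) measurable
  \<comment> \<open>c / \<rho>^2 is the exponent of \<open>gauss (1 / \<rho>)\<close> at distance s
    |v|.\<close>
  define c where "c = pi * (s * norm v)\<^sup>2"
  have c: "c > 0" using v s by (simp add: c_def)
  define I where "I \<rho> = (LINT y|lborel. gauss_cut D y * cis (- (2 * pi * s * (y \<bullet> v))) * gauss \<rho> y)" for \<rho>
  have I_le: "cmod (I \<rho>) \<le> (1 / \<rho>) ^ ?n * exp (- c * (1 / \<rho>)\<^sup>2)" if \<rho>: "\<rho> > 0" for \<rho>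
  proof -
    define g where "g = (\<lambda>y::'a. complex_of_real (gauss \<rho> y))"
    define G where "G = (\<lambda>z::'a \<times> 'a. complex_of_real (gauss 1 z))"
    have g: "integrable lborel g"
      using gauss_integrable(1)[OF \<rho>, where 'a='a] unfolding g_def complex_of_real_integrable_eq .
    have G: "integrable lborel G"
      using gauss_integrable(1)[of 1, where 'a="'a \<times> 'a"] unfolding G_def complex_of_real_integrable_eq by simp
    \<comment> \<open>All phases and the cutoff are collected in a kernel of modulus at most 1,
      leaving two integrable Gaussians, so that the y-integral can be done first.\<close>
    define k where "k y z = indicator D z * cis (2 * pi * (y \<bullet> (fst z + snd z - s *\<^sub>R v)))" for y :: 'a and z :: "'a \<times> 'a"
    have k_eq: "indicator D z * (cis (2 * pi * (z \<bullet> (y, y))) * gauss 1 z) * cis (- (2 * pi * s * (y \<bullet> v))) * gauss \<rho> y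
       = k y z * g y * G z" for y z
    proof -
      have "2 * pi * (y \<bullet> (fst z + snd z - s *\<^sub>R v)) = 2 * pi * (z \<bullet> (y, y)) + - (2 * pi * s * (y \<bullet> v))"
        by (cases z) (simp add: inner_commute inner_right_distrib inner_diff_right algebra_simps)
      then have "cis (2 * pi * (y \<bullet> (fst z + snd z - s *\<^sub>R v))) = cis (2 * pi * (z \<bullet> (y, y))) * cis (- (2 * pi * s * (y \<bullet> v)))"
        by (simp only: cis_mult)
      then show ?thesis by (simp add: k_def g_def G_def mult_ac)
    qed
    have "I \<rho> = (LINT y|lborel. LINT z|lborel. k y z * g y * G z)"
      unfolding I_def gauss_cut_def k_eq[symmetric] integral_mult_left_zero ..
    also have "\<dots> = (LINT z|lborel. LINT y|lborel. k y z * g y * G z)"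
    proof (rule fubini_bounded[OF g G, where B = 1])
      have [measurable]: "fst \<in> borel_measurable (borel :: ('a \<times> 'a) measure)" "snd \<in> borel_measurable (borel :: ('a \<times> 'a) measure)"
        by (intro borel_measurable_continuous_onI continuous_intros)+
      show "(\<lambda>p. k (fst p) (snd p)) \<in> borel_measurable (borel \<Otimes>\<^sub>M borel)"
        unfolding k_def by measurable
      show "cmod (k y z) \<le> 1" for y z by (auto simp: k_def norm_mult indicator_def)
    qed
    also have "\<dots> = (LINT z|lborel. indicator D z * complex_of_real ((1 / \<rho>) ^ ?n * gauss (1 / \<rho>) (fst z + snd z - s *\<^sub>R v) * gauss 1 z))"
    proof (rule Bochner_Integration.integral_cong[OF refl])
      fix z :: "'a \<times> 'a"
      have "(LINT y|lborel. k y z * g y * G z) =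
        indicator D z * (LINT y|lborel. cis (2 * pi * (y \<bullet> (fst z + snd z - s *\<^sub>R v))) * gauss \<rho> y) * G z"
        unfolding k_def g_def integral_mult_left_zero by (simp add: mult.assoc)
      also have "\<dots> = indicator D z * complex_of_real ((1 / \<rho>) ^ ?n * gauss (1 / \<rho>) (fst z + snd z - s *\<^sub>R v)) * G z"
        using has_bochner_integral_gauss_fourier[OF \<rho>, of "fst z + snd z - s *\<^sub>R v"] unfolding has_bochner_integral_iff by simp
      finally show "(LINT y|lborel. k y z * g y * G z) =
          indicator D z * complex_of_real ((1 / \<rho>) ^ ?n * gauss (1 / \<rho>) (fst z + snd z - s *\<^sub>R v) * gauss 1 z)"
        by (simp add: G_def mult_ac)
    qed
    also have "cmod \<dots> \<le> (LINT z|lborel. (1 / \<rho>) ^ ?n * exp (- c * (1 / \<rho>)\<^sup>2) * gauss 1 (z :: 'a \<times> 'a))"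
    proof (rule order_trans[OF integral_norm_bound integral_mono'])
      show "integrable lborel (\<lambda>z :: 'a \<times> 'a. (1 / \<rho>) ^ ?n * exp (- c * (1 / \<rho>)\<^sup>2) * gauss 1 z)"
        using gauss_integrable(1)[of 1, where 'a="'a \<times> 'a"] by simp
      fix z :: "'a \<times> 'a"
      have "gauss (1 / \<rho>) (fst z + snd z - s *\<^sub>R v) \<le> exp (- c * (1 / \<rho>)\<^sup>2)" if "z \<in> D"
      proof -
        \<comment> \<open>Testing the difference \<xi> + \<eta> - s v against v, Cauchy-Schwarz
          yields the separation s |v|.\<close>
        have "v \<bullet> (fst z + snd z) < 0" using that by (cases z) (simp add: D_def inner_add_right)
        then have "s * (norm v)\<^sup>2 \<le> - (v \<bullet> (fst z + snd z - s *\<^sub>R v))"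
          by (simp add: inner_diff_right power2_norm_eq_inner)
        also have "\<dots> \<le> norm v * norm (fst z + snd z - s *\<^sub>R v)"
          using Cauchy_Schwarz_ineq2[of v "fst z + snd z - s *\<^sub>R v"] by linarith
        finally have "s * norm v \<le> norm (fst z + snd z - s *\<^sub>R v)"
          using v by (simp add: power2_eq_square)
        then have "(s * norm v)\<^sup>2 \<le> (norm (fst z + snd z - s *\<^sub>R v))\<^sup>2"
          using s by (intro power_mono) auto
        then have "pi * ((s * norm v)\<^sup>2 * (1 / \<rho>)\<^sup>2) \<le> pi * ((norm (fst z + snd z - s *\<^sub>R v))\<^sup>2 * (1 / \<rho>)\<^sup>2)"
          by (intro mult_left_mono mult_right_mono) auto
        then show ?thesis by (simp add: gauss_def c_def power_mult_distrib power_divide mult_ac)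
      qed
      then show "cmod (indicator D z * complex_of_real ((1 / \<rho>) ^ ?n * gauss (1 / \<rho>) (fst z + snd z - s *\<^sub>R v) * gauss 1 z))
         \<le> (1 / \<rho>) ^ ?n * exp (- c * (1 / \<rho>)\<^sup>2) * gauss 1 z"
        using \<rho> by (auto simp: norm_mult indicator_def norm_power norm_divide intro!: mult_right_mono mult_left_mono)
    qed (use \<rho> in simp)
    also have "\<dots> = (1 / \<rho>) ^ ?n * exp (- c * (1 / \<rho>)\<^sup>2)"
      using gauss_integrable(2)[of 1, where 'a="'a \<times> 'a"] by simp
    finally show ?thesis .
  qed
  have "(\<lambda>k. I (inverse (real (Suc k)))) \<longlonglongrightarrow> 0"
  proof (rule Lim_null_comparison[OF _ power_times_gaussian_tendsto_0[OF c, of ?n]])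
    show "\<forall>\<^sub>F k in sequentially. cmod (I (inverse (real (Suc k)))) \<le> real (Suc k) ^ ?n * exp (- c * (real (Suc k))\<^sup>2)"
      using I_le[of "inverse (real (Suc _))"] by (auto simp: divide_inverse simp del: of_nat_Suc)
  qed
  moreover have "(\<lambda>k. I (inverse (real (Suc k)))) \<longlonglongrightarrow> (LINT y|lborel. gauss_cut D y * cis (- (2 * pi * s * (y \<bullet> v))))"
    unfolding I_def
  proof (rule integral_dominated_convergence)
    \<comment> \<open>The assumed integrability provides the majorant for removing the regularising
      Gaussian.\<close>
    show "integrable lborel (\<lambda>y. cmod (gauss_cut D y))" using T' by simp
    have "(\<lambda>k. gauss_cut D y * cis (- (2 * pi * s * (y \<bullet> v))) * complex_of_real (gauss (inverse (real (Suc k))) y))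
       \<longlonglongrightarrow> gauss_cut D y * cis (- (2 * pi * s * (y \<bullet> v))) * complex_of_real (exp (- pi * (0 * norm y)\<^sup>2))" for y
      unfolding gauss_def by (intro tendsto_intros LIMSEQ_inverse_real_of_nat)
    then show "AE y in lborel. (\<lambda>k. gauss_cut D y * cis (- (2 * pi * s * (y \<bullet> v))) * complex_of_real (gauss (inverse (real (Suc k))) y))
       \<longlonglongrightarrow> gauss_cut D y * cis (- (2 * pi * s * (y \<bullet> v)))"
      by simp
    show "AE y in lborel. cmod (gauss_cut D y * cis (- (2 * pi * s * (y \<bullet> v))) * complex_of_real (gauss (inverse (real (Suc k))) y))
        \<le> cmod (gauss_cut D y)" for k
      using gauss_le_1 by (intro AE_I2) (auto simp: norm_mult intro!: mult_left_le)
  qed measurable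
  ultimately show ?thesis unfolding D_def by (rule LIMSEQ_unique[rotated])
qed

text \<open>The Fourier transform of an integrable function is continuous, but here it vanishes on the ray
  through \<open>v\<close> and has positive real part at the origin.\<close>

lemma gauss_cut_halfspace_not_integrable:
  fixes v :: "'a::euclidean_space"
  assumes v: "v \<noteq> 0"
  shows "\<not> integrable lborel (gauss_cut {z. (v, v) \<bullet> z < 0})"
proof
  let ?T = "gauss_cut {z. (v, v) \<bullet> z < 0}"
  assume T: "integrable lborel ?T"
  then have [measurable]: "?T \<in> borel_measurable borel" by (auto dest: borel_measurable_integrable)
  have "(\<lambda>k. LINT y|lborel. ?T y * cis (- (2 * pi * inverse (real (Suc k)) * (y \<bullet> v)))) \<longlonglongrightarrow> (LINT y|lborel. ?T y)"
  proof (rule integral_dominated_convergence)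
    show "integrable lborel (\<lambda>y. cmod (?T y))" using T by simp
    have "(\<lambda>k. ?T y * cis (- (2 * pi * inverse (real (Suc k)) * (y \<bullet> v)))) \<longlonglongrightarrow> ?T y * cis (- (2 * pi * 0 * (y \<bullet> v)))" for y
      by (intro tendsto_intros LIMSEQ_inverse_real_of_nat)
    then show "AE y in lborel. (\<lambda>k. ?T y * cis (- (2 * pi * inverse (real (Suc k)) * (y \<bullet> v)))) \<longlonglongrightarrow> ?T y"
      by simp
  qed (auto simp: norm_mult)
  moreover have "(LINT y|lborel. ?T y * cis (- (2 * pi * inverse (real (Suc k)) * (y \<bullet> v)))) = 0" for k
    by (rule integral_gauss_cut_halfspace_eq_0[OF v _ T]) simp
  ultimately have "(LINT y|lborel. ?T y) = 0"
    by (simp add: LIMSEQ_const_iff)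
  \<comment> \<open>Adding the conjugate replaces the cut Gaussian by the full one, whose integral
    (1 / sqrt 2)^n is nonzero.\<close>
  then have "0 = (LINT y|lborel. ?T y) + cnj (LINT y|lborel. ?T y)" by simp
  also have "\<dots> = (LINT y|lborel. ?T y + cnj (?T y))"
    using T by (simp add: Bochner_Integration.integral_add)
  also have "\<dots> = (LINT y|lborel. complex_of_real (gauss (sqrt 2) (y :: 'a)))"
    using v by (simp add: gauss_cut_halfspace_real_part zero_prod_def)
  also have "\<dots> = complex_of_real ((1 / sqrt 2) ^ DIM('a))"
    using gauss_integrable(2)[of "sqrt 2", where 'a='a] by simp
  finally show False by simp
qed

lemma not_bilinear_bounded_BR_0:
  "\<not> bilinear_bounded 2 2 1 (bilinear_BR 0 :: ('a::euclidean_space \<Rightarrow> complex) \<Rightarrow> ('a \<Rightarrow> complex) \<Rightarrow> 'a \<Rightarrow> complex)"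
proof
  assume "bilinear_bounded 2 2 1 (bilinear_BR 0 :: ('a \<Rightarrow> complex) \<Rightarrow> ('a \<Rightarrow> complex) \<Rightarrow> 'a \<Rightarrow> complex)"
  then obtain C where C: "bilinear_bound 2 2 1 (bilinear_BR 0 :: ('a \<Rightarrow> complex) \<Rightarrow> ('a \<Rightarrow> complex) \<Rightarrow> 'a \<Rightarrow> complex) C"
    unfolding bilinear_bounded_def by blast
  obtain b :: 'a where "b \<in> Basis" using nonempty_Basis by blast
  then have b: "norm b = 1" by simp
  define v where "v = (1 / sqrt 2) *\<^sub>R b"
  have v: "v \<noteq> 0" using b by (auto simp: v_def)
  let ?D = "{z. (v, v) \<bullet> z < 0}"
  have m: "gauss_cut D \<in> borel_measurable borel" if "D \<in> sets borel" for D :: "('a \<times> 'a) set"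
    using that by (rule gauss_cut_measurable)
  have [measurable]: "gauss_cut {z. 2 * ((v, v) \<bullet> z) + r * (norm z)\<^sup>2 \<le> 0} \<in> borel_measurable borel" for r
    by (rule m) measurable
  have [measurable]: "gauss_cut ?D \<in> borel_measurable borel"
    by (rule m) simp
  \<comment> \<open>Take r = 1 / (k + 1): the bound is the same for all k, so Fatou transfers it to
    the half-space limit and makes that limit integrable.\<close>
  have "(\<integral>\<^sup>+y. ennreal (cmod (gauss_cut ?D y)) \<partial>lborel) \<le> ennreal (C * (1 / sqrt 2) ^ DIM('a))"
  proof (rule nn_integral_le_of_tendsto)
    let ?E = "\<lambda>k. {z. 2 * ((v, v) \<bullet> z) + inverse (real (Suc k)) * (norm z)\<^sup>2 \<le> 0}"
    show "(\<lambda>y. ennreal (cmod (gauss_cut (?E k) y))) \<in> borel_measurable lborel" for k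
      by measurable
    show "AE y in lborel. (\<lambda>k. ennreal (cmod (gauss_cut (?E k) y))) \<longlonglongrightarrow> ennreal (cmod (gauss_cut ?D y))"
      by (intro AE_I2 tendsto_ennrealI tendsto_norm gauss_cut_ball_tendsto)
    show "(\<integral>\<^sup>+y. ennreal (cmod (gauss_cut (?E k) y)) \<partial>lborel) \<le> ennreal (C * (1 / sqrt 2) ^ DIM('a))" for k
      unfolding v_def by (rule gauss_cut_ball_norm_le[OF C b]) simp
  qed
  then have "integrable lborel (gauss_cut ?D)"
    by (intro integrableI_bounded) (auto intro: le_less_trans)
  with gauss_cut_halfspace_not_integrable[OF v] show False by contradiction
qed

theorem theorem4p7:
  assumes "CARD('n::finite) \<ge> 2"
  shows "(\<forall>\<delta>>0.
            bilinear_bounded 2 2 1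
              (bilinear_BR \<delta> :: (real ^ 'n \<Rightarrow> complex) \<Rightarrow> (real ^ 'n \<Rightarrow> complex) \<Rightarrow> real ^ 'n \<Rightarrow> complex) \<and>
            (\<exists>C::real. bilinear_opnorm 2 2 1
              (bilinear_BR \<delta> :: (real ^ 'n \<Rightarrow> complex) \<Rightarrow> (real ^ 'n \<Rightarrow> complex) \<Rightarrow> real ^ 'n \<Rightarrow> complex)
                \<le> ennreal C)) \<and>
         \<not> bilinear_bounded 2 2 1
              (bilinear_BR 0 :: (real ^ 'n \<Rightarrow> complex) \<Rightarrow> (real ^ 'n \<Rightarrow> complex) \<Rightarrow> real ^ 'n \<Rightarrow> complex)"
proof (intro conjI allI impI)
  fix \<delta> :: real
  assume "\<delta> > 0"
  note bound = bilinear_BR_bound_of_pos[OF this, where 'a="real ^ 'n"]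
  then show "bilinear_bounded 2 2 1
      (bilinear_BR \<delta> :: (real ^ 'n \<Rightarrow> complex) \<Rightarrow> (real ^ 'n \<Rightarrow> complex) \<Rightarrow> real ^ 'n \<Rightarrow> complex)"
    unfolding bilinear_bounded_def by blast
  show "\<exists>C::real. bilinear_opnorm 2 2 1
      (bilinear_BR \<delta> :: (real ^ 'n \<Rightarrow> complex) \<Rightarrow> (real ^ 'n \<Rightarrow> complex) \<Rightarrow> real ^ 'n \<Rightarrow> complex) \<le> ennreal C"
    unfolding bilinear_opnorm_def by (rule exI, rule Inf_lower, rule imageI, rule CollectI, rule bound)
qed (rule not_bilinear_bounded_BR_0)

end
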